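(* Let $(\mathbb{X},\|\cdot\|_{\mathbb{X}})$ be a complex Banach space. If $u\in BC(\mathbb{R}\to\mathbb{X})$ and $\lambda\in\mathbb{C}\setminus i\mathbb{R}$, then $$\liminf_{n\to\infty}\|(\lambda-D)^{-n}u\|_\infty^{1/n}\ \ge\ \sup\{|\lambda-i\xi|^{-1}:\xi\in\mathrm{Spec}(u)\}.$$ Moreover, if the Beurling spectrum $\mathrm{Spec}(u)$ is compact, then $$\lim_{n\to\infty}\|(\lambda-D)^{-n}u\|_\infty^{1/n}=\sup\{|\lambda-i\xi|^{-1}:\xi\in\mathrm{Spec}(u)\}.$$
   Context: $BC(\mathbb{R}\to\mathbb{X})$ is the Banach space of bounded continuous functions $u:\mathbb{R}\to\mathbb{X}$ with norm $\|u\|_\infty=\sup\{\|u(t)\|_{\mathbb{X}}:t\in\mathbb{R}\}$. $D$ is the (unbounded) differentiation operator $Du(s)=\lim_{\delta\to0}\frac{u(s+\delta)-u(s)}{\delta}$ on $BC(\mathbb{R}\to\mathbb{X})$. For $\lambda\in\mathbb{C}\setminus i\mathbb{R}$ the operator $\lambda-D$ is invertible, with bounded inverse on $BC(\mathbb{R}\to\mathbb{X})$ given by $$(\lambda-D)^{-1}u(\xi)=\begin{cases}\int_0^\infty e^{-\lambda t}u(\xi+t)\,dt&\text{if }\operatorname{Re}\lambda>0,\\[2pt]-\int_0^\infty e^{\lambda t}u(\xi-t)\,dt&\text{if }\operatorname{Re}\lambda<0,\end{cases}$$ and $(\lambda-D)^{-n}$ denotes the $n$-th power of this inverse. $\mathcal{S}$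 denotes the set of (complex-valued) Schwartz functions on $\mathbb{R}$; for $\varphi\in\mathcal{S}$, $\hat\varphi(s)=\int_{-\infty}^{\infty}e^{-ist}\varphi(t)\,dt$ and $(\varphi*u)(s)=\int_{-\infty}^{\infty}\varphi(s-t)u(t)\,dt$. The Beurling spectrum of $u$ is $$\mathrm{Spec}(u)=\{\xi\in\mathbb{R}:\ \forall\varepsilon>0\ \exists\varphi\in\mathcal{S}\text{ with }\operatorname{supp}\hat\varphi\subset(\xi-\varepsilon,\xi+\varepsilon)\text{ and }\varphi*u\neq0\},$$ where $\varphi*u\ne 0$ means that $\varphi*u$ is not identically zero. The supremum of the empty set is taken to be $0$. *)

theory Defs
  imports "HOL-Analysis.Analysis"
begin

section \<open>Complex Banach spaces\<close>

text \<open>The Analysis library has type classes for real Banach spaces only.  A complex Banach space is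
  a real one with a complex scalar multiplication that extends the real one and for which the norm
  is homogeneous.\<close>

class scaleC =
  fixes scaleC :: "complex \<Rightarrow> 'a \<Rightarrow> 'a" (infixr \<open>*\<^sub>C\<close> 75)

class complex_vector = real_vector + scaleC +
  assumes scaleC_add_right: "c *\<^sub>C (x + y) = c *\<^sub>C x + c *\<^sub>C y"
    and scaleC_add_left: "(c + d) *\<^sub>C x = c *\<^sub>C x + d *\<^sub>C x"
    and scaleC_scaleC: "c *\<^sub>C d *\<^sub>C x = (c * d) *\<^sub>C x"
    and scaleC_of_real: "complex_of_real r *\<^sub>C x = r *\<^sub>R x"

class complex_normed_vector = complex_vector + real_normed_vector +
  assumes norm_scaleC: "norm (c *\<^sub>C x) = cmod c * norm x"

class complex_banach = complex_normed_vector + banach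

lemma scaleC_one [simp]: "1 *\<^sub>C x = (x :: 'a :: complex_vector)"
  using scaleC_of_real[of 1 x] by simp

lemma bounded_bilinear_scaleC:
  "bounded_bilinear ((*\<^sub>C) :: complex \<Rightarrow> 'a \<Rightarrow> 'a :: complex_normed_vector)"
proof
  show "(r *\<^sub>R c) *\<^sub>C x = r *\<^sub>R (c *\<^sub>C x)" for r c and x :: 'a
    by (simp add: scaleR_conv_of_real scaleC_of_real flip: scaleC_scaleC)
  show "c *\<^sub>C (r *\<^sub>R x) = r *\<^sub>R (c *\<^sub>C x)" for r c and x :: 'a
    by (simp add: scaleC_scaleC mult.commute flip: scaleC_of_real)
  show "\<exists>K. \<forall>a b. norm (a *\<^sub>C (b::'a)) \<le> norm a * norm b * K"
    by (intro exI[of _ 1]) (simp add: norm_scaleC)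
qed (simp_all add: scaleC_add_right scaleC_add_left)

interpretation scaleC: bounded_bilinear "(*\<^sub>C) :: complex \<Rightarrow> 'a \<Rightarrow> 'a :: complex_normed_vector"
  by (rule bounded_bilinear_scaleC)

lemma continuous_on_scaleC [continuous_intros]:
  fixes g :: "'b::topological_space \<Rightarrow> 'a :: complex_normed_vector"
  shows "continuous_on S f \<Longrightarrow> continuous_on S g \<Longrightarrow> continuous_on S (\<lambda>x. f x *\<^sub>C g x)"
  by (rule scaleC.continuous_on)

instantiation complex :: complex_banach
begin

definition scaleC_complex :: "complex \<Rightarrow> complex \<Rightarrow> complex"
  where "scaleC_complex c z = c * z"

instance
  by standard (simp_all add: scaleC_complex_def algebra_simps scaleR_conv_of_real norm_mult)

end

instantiation bcontfun :: (topological_space, complex_normed_vector) complex_normed_vector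
begin

definition scaleC_bcontfun :: "complex \<Rightarrow> ('a \<Rightarrow>\<^sub>C 'b) \<Rightarrow> 'a \<Rightarrow>\<^sub>C 'b"
  where "scaleC_bcontfun c f = Bcontfun (\<lambda>x. c *\<^sub>C f x)"

lemma apply_bcontfun_scaleC [simp]: "apply_bcontfun (c *\<^sub>C f) x = c *\<^sub>C f x"
  for f :: "'a \<Rightarrow>\<^sub>C 'b"
proof -
  have "(\<lambda>x. c *\<^sub>C f x) \<in> bcontfun"
    by (intro bcontfun_normI[where b = "cmod c * norm f"] continuous_intros)
       (simp_all add: norm_scaleC norm_bounded mult_left_mono)
  then show ?thesis
    by (simp add: scaleC_bcontfun_def Bcontfun_inverse)
qed

lemma norm_scaleC_bcontfun_le: "norm (c *\<^sub>C f) \<le> cmod c * norm f"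
  for f :: "'a \<Rightarrow>\<^sub>C 'b"
  by (rule norm_bound) (simp add: norm_scaleC norm_bounded mult_left_mono)

instance
proof
  fix c d :: complex and r :: real and f g :: "'a \<Rightarrow>\<^sub>C 'b"
  show "c *\<^sub>C (f + g) = c *\<^sub>C f + c *\<^sub>C g"
    by (rule bcontfun_eqI) (simp add: scaleC_add_right)
  show "(c + d) *\<^sub>C f = c *\<^sub>C f + d *\<^sub>C f"
    by (rule bcontfun_eqI) (simp add: scaleC_add_left)
  show *: "c *\<^sub>C d *\<^sub>C f = (c * d) *\<^sub>C f" for c d and f :: "'a \<Rightarrow>\<^sub>C 'b"
    by (rule bcontfun_eqI) (simp add: scaleC_scaleC)
  show "complex_of_real r *\<^sub>C f = r *\<^sub>R f"
    by (rule bcontfun_eqI) (simp add: scaleC_of_real)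
  show "norm (c *\<^sub>C f) = cmod c * norm f"
  proof (cases "c = 0")
    case True
    then show ?thesis
      using norm_scaleC_bcontfun_le[of c f] by simp
  next
    case False
    have "1 *\<^sub>C f = f"
      by (rule bcontfun_eqI) (simp)
    then have "norm f = norm (inverse c *\<^sub>C c *\<^sub>C f)"
      using False by (simp add: *)
    also have "\<dots> \<le> cmod (inverse c) * norm (c *\<^sub>C f)"
      by (rule norm_scaleC_bcontfun_le)
    finally have "cmod c * norm f \<le> norm (c *\<^sub>C f)"
      using False by (simp add: norm_inverse norm_divide field_simps)
    then show ?thesis
      using norm_scaleC_bcontfun_le[of c f] by simp
  qed
qed

end

instance bcontfun :: (metric_space, complex_banach) complex_banach ..


section \<open>The differentiation operator and its resolvent\<close>

definition diff_dom :: "(real \<Rightarrow>\<^sub>C 'a::complex_banach) set"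
  where "diff_dom = {v. \<exists>w :: real \<Rightarrow>\<^sub>C 'a. \<forall>s. (apply_bcontfun v has_vector_derivative w s) (at s)}"

definition diff_op :: "(real \<Rightarrow>\<^sub>C 'a::complex_banach) \<Rightarrow> (real \<Rightarrow>\<^sub>C 'a)"
  where "diff_op v = Bcontfun (\<lambda>s. vector_derivative v (at s))"

definition diff_resolvent :: "complex \<Rightarrow> (real \<Rightarrow>\<^sub>C 'a::complex_banach) \<Rightarrow> (real \<Rightarrow>\<^sub>C 'a)"
  where "diff_resolvent \<mu> = inv_into diff_dom (\<lambda>v. \<mu> *\<^sub>C v - diff_op v)"

lemma diff_op_eqI:
  assumes "\<And>s. (apply_bcontfun v has_vector_derivative apply_bcontfun w s) (at s)"
  shows "diff_op v = w"
proof -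
  have "(\<lambda>s. vector_derivative v (at s)) = apply_bcontfun w"
    using assms by (intro ext vector_derivative_at)
  then show ?thesis
    by (simp add: diff_op_def apply_bcontfun_inverse)
qed

lemma has_vector_derivative_diff_op:
  "v \<in> diff_dom \<Longrightarrow> (apply_bcontfun v has_vector_derivative apply_bcontfun (diff_op v) s) (at s)"
  using diff_op_eqI by (fastforce simp: diff_dom_def)

lemma has_vector_derivative_exp_scaleC:
  fixes v :: "real \<Rightarrow> 'a::complex_normed_vector"
  assumes "(v has_vector_derivative v') (at (a + t))"
  shows "((\<lambda>t. exp (c * of_real t) *\<^sub>C v (a + t)) has_vector_derivative
           exp (c * of_real t) *\<^sub>C (c *\<^sub>C v (a + t) + v')) (at t)"
proof -
  have "((\<lambda>t. v (a + t)) has_vector_derivative 1 *\<^sub>R v') (at t)"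
    by (rule vector_diff_chain_at[where f = "\<lambda>t. a + t", unfolded o_def])
       (auto intro!: derivative_eq_intros assms)
  moreover have "((\<lambda>t. exp (c * of_real t)) has_vector_derivative c * exp (c * of_real t)) (at t)"
    by (rule has_vector_derivative_real_field) (auto intro!: derivative_eq_intros)
  ultimately show ?thesis
    using scaleC.has_vector_derivative[of "\<lambda>t. exp (c * of_real t)" _ t UNIV "\<lambda>t. v (a + t)" v']
    by (simp add: scaleC_add_right scaleC_scaleC mult.commute[of _ c]
        add.commute[of "exp (c * of_real t) *\<^sub>C v'"])
qed

lemma bounded_solution_has_integral:
  fixes v f :: "real \<Rightarrow> 'a::complex_banach"
  assumes "Re \<mu> > 0"
    and v': "\<And>s. (v has_vector_derivative \<mu> *\<^sub>C v s - f s) (at s)"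
    and bound: "\<And>s. norm (v s) \<le> B"
  shows "((\<lambda>t. exp (- (\<mu> * of_real t)) *\<^sub>C f (\<xi> + t)) has_integral v \<xi>) {0..}"
proof -
  define F where "F t = - (exp ((-\<mu>) * of_real t) *\<^sub>C v (\<xi> + t))" for t
  have F': "(F has_vector_derivative exp (- (\<mu> * of_real t)) *\<^sub>C f (\<xi> + t)) (at t)" for t
    using has_vector_derivative_minus[OF has_vector_derivative_exp_scaleC[OF v', of "-\<mu>" \<xi> t]]
    by (simp add: F_def[abs_def] scaleC.minus_left scaleC.minus_right flip: scaleC.minus_right)
  have normF: "norm (F t) \<le> B * exp (- Re \<mu> * t)" for t
    using bound[of "\<xi> + t"] by (simp add: F_def norm_scaleC mult.commute mult_right_mono)
  have "((\<lambda>t. B * exp (- Re \<mu> * t)) \<longlongrightarrow> B * 0) at_top"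
    using assms(1)
    by (intro tendsto_mult tendsto_const filterlim_compose[OF exp_at_bot]
          filterlim_tendsto_neg_mult_at_bot[OF tendsto_const] filterlim_ident) auto
  then have F0: "(F \<longlongrightarrow> 0) at_top"
    by (intro Lim_null_comparison[OF always_eventually[OF allI[OF normF]]]) simp
  let ?g = "\<lambda>t. if t \<in> {0..} then exp (- (\<mu> * of_real t)) *\<^sub>C f (\<xi> + t) else 0"
  have "\<nexists>a b. {0::real..} = cbox a b"
  proof safe
    fix a b :: real
    assume "{0..} = cbox a b"
    moreover have "max 0 (b + 1) \<in> {0..}" "max 0 (b + 1) \<notin> cbox a b"
      by auto
    ultimately show False
      by blast
  qed
  moreover have "\<exists>B>0. \<forall>a b. ball 0 B \<subseteq> cbox a b \<longrightarrow>
      (\<exists>z. (?g has_integral z) (cbox a b) \<and> norm (z - v \<xi>) < e)" if "e > 0" for e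
  proof -
    obtain M where M: "\<And>t. t \<ge> M \<Longrightarrow> norm (F t) < e"
      using tendstoD[OF F0 \<open>e > 0\<close>] by (auto simp: eventually_at_top_linorder)
    show ?thesis
    proof (intro exI[of _ "max 1 M + 1"] conjI allI impI)
      fix a b :: real
      assume sub: "ball 0 (max 1 M + 1) \<subseteq> cbox a b"
      have "0 \<in> cbox a b" "max 1 M \<in> cbox a b"
        by (rule subsetD[OF sub]; simp)+
      then have ab: "a \<le> 0" "0 \<le> b" "M \<le> b"
        by auto
      have "((\<lambda>t. exp (- (\<mu> * of_real t)) *\<^sub>C f (\<xi> + t)) has_integral F b - F 0) {0..b}"
        using ab by (intro fundamental_theorem_of_calculus has_vector_derivative_at_within[OF F']) auto
      then have "((\<lambda>t. if t \<in> {0..b} then exp (- (\<mu> * of_real t)) *\<^sub>C f (\<xi> + t) else 0)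
          has_integral F b - F 0) (cbox a b)"
        using ab by (subst has_integral_restrict) auto
      then have "(?g has_integral F b - F 0) (cbox a b)"
        by (rule has_integral_eq[rotated]) auto
      moreover have "norm (F b - F 0 - v \<xi>) < e"
        using M[OF ab(3)] by (simp add: F_def)
      ultimately show "\<exists>z. (?g has_integral z) (cbox a b) \<and> norm (z - v \<xi>) < e"
        by blast
    qed auto
  qed
  ultimately show ?thesis
    by (subst has_integral_alt) auto
qed

lemma continuous_antiderivative:
  fixes g :: "real \<Rightarrow> 'a::banach"
  assumes "continuous_on UNIV g"
  obtains G where "\<And>x. (G has_vector_derivative g x) (at x)"
proof
  define G where "G x = integral {0..x} g - integral {x..0} g" for x
  fix x :: real
  define M where "M = \<bar>x\<bar> + 1"
  have cont: "continuous_on S g" for S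
    using assms continuous_on_subset by blast
  have int: "g integrable_on {a..b}" for a b
    by (rule integrable_continuous_real[OF cont])
  have eq: "integral {-M..y} g - integral {-M..0} g = G y" if "y \<in> {-M<..<M}" for y
  proof (cases "0 \<le> y")
    case True
    have "integral {-M..0} g + integral {0..y} g = integral {-M..y} g"
      using True by (intro Henstock_Kurzweil_Integration.integral_combine int) (auto simp: M_def)
    moreover have "integral {y..0} g = 0"
      using True by (cases "y = 0") auto
    ultimately show ?thesis
      by (simp add: G_def algebra_simps)
  next
    case False
    have "integral {-M..y} g + integral {y..0} g = integral {-M..0} g"
      using False that by (intro Henstock_Kurzweil_Integration.integral_combine int) auto
    then show ?thesis
      using False by (simp add: G_def algebra_simps)
  qed
  have "((\<lambda>y. integral {-M..y} g) has_vector_derivative g x) (at x within {-M..M})"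
    by (rule integral_has_vector_derivative[OF cont]) (auto simp: M_def)
  moreover have "at x within {-M..M} = at x"
    by (rule at_within_interior) (auto simp: M_def)
  ultimately have "((\<lambda>y. integral {-M..y} g - integral {-M..0} g) has_vector_derivative g x) (at x)"
    by (auto intro!: derivative_eq_intros)
  then show "(G has_vector_derivative g x) (at x)"
    by (rule has_vector_derivative_transform_within_open[where S = "{-M<..<M}"])
       (auto simp: eq, auto simp: M_def)
qed

lemma bounded_solution_exists:
  fixes f :: "real \<Rightarrow> 'a::complex_banach"
  assumes pos: "Re \<mu> > 0" and cont: "continuous_on UNIV f" and bound: "\<And>s. norm (f s) \<le> B"
  obtains v where "\<And>s. (v has_vector_derivative \<mu> *\<^sub>C v s - f s) (at s)"
    and "\<And>s. norm (v s) \<le> B / Re \<mu>"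
proof -
  have "continuous_on UNIV (\<lambda>s. exp ((-\<mu>) * of_real s) *\<^sub>C f s)"
    by (intro continuous_intros cont)
  then obtain G where
    G': "\<And>s. (G has_vector_derivative exp ((-\<mu>) * of_real s) *\<^sub>C f s) (at s)"
    by (rule continuous_antiderivative) blast
  define \<phi> where "\<phi> s = - (B / Re \<mu> * exp (- Re \<mu> * s))" for s
  have \<phi>': "(\<phi> has_vector_derivative B * exp (- Re \<mu> * s)) (at s)" for s
    using pos unfolding \<phi>_def has_real_derivative_iff_has_vector_derivative[symmetric]
    by (auto intro!: derivative_eq_intros)
  have B0: "B \<ge> 0"
    using bound[of 0] norm_ge_zero order_trans by blast
  have diff: "norm (G y - G x) \<le> \<phi> y - \<phi> x" if "x < y" for x y
  proof (rule differentiable_bound_general[OF that _ _ G' \<phi>'])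
    show "continuous_on {x..y} G" "continuous_on {x..y} \<phi>"
      using G' \<phi>' by (auto intro!: continuous_at_imp_continuous_on has_vector_derivative_continuous)
    show "norm (exp ((-\<mu>) * of_real s) *\<^sub>C f s) \<le> B * exp (- Re \<mu> * s)" for s
      using bound[of s] by (simp add: norm_scaleC mult.commute mult_right_mono)
  qed
  have \<phi>_nonpos: "\<phi> x \<le> 0" for x
    using pos B0 by (simp add: \<phi>_def)
  have tail: "norm (G y - G x) \<le> - \<phi> x" if "x \<le> y" for x y
    using that diff[of x y] \<phi>_nonpos[of x] \<phi>_nonpos[of y] by (cases "x = y") auto
  have "((\<lambda>x. - (B / Re \<mu> * exp (- Re \<mu> * x))) \<longlongrightarrow> - (B / Re \<mu> * 0)) at_top"
    using pos
    by (intro tendsto_mult tendsto_minus tendsto_const filterlim_compose[OF exp_at_bot]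
          filterlim_tendsto_neg_mult_at_bot[OF tendsto_const] filterlim_ident) auto
  then have \<phi>0: "(\<phi> \<longlongrightarrow> 0) at_top"
    by (simp add: \<phi>_def[abs_def])
  have "Cauchy (\<lambda>n. G (real n))"
  proof (rule metric_CauchyI)
    fix e :: real assume "e > 0"
    then have "\<forall>\<^sub>F x in at_top. norm (\<phi> x) < e / 2"
      using tendstoD[OF \<phi>0, of "e / 2"] by simp
    then obtain M where M: "\<And>x. x \<ge> M \<Longrightarrow> norm (\<phi> x) < e / 2"
      by (auto simp: eventually_at_top_linorder)
    obtain N :: nat where N: "M \<le> real N"
      using real_arch_simple by blast
    have "norm (G (real n) - G (real N)) < e / 2" if "n \<ge> N" for n
      using tail[of "real N" "real n"] M[OF N] that by auto
    then have "dist (G (real m)) (G (real n)) < e" if "m \<ge> N" "n \<ge> N" for m n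
      using that dist_triangle_half_l[of "G (real m)" "G (real N)" e "G (real n)"]
      by (simp add: dist_norm)
    then show "\<exists>N. \<forall>m\<ge>N. \<forall>n\<ge>N. dist (G (real m)) (G (real n)) < e"
      by blast
  qed
  then obtain K where K: "(\<lambda>n. G (real n)) \<longlonglongrightarrow> K"
    using Cauchy_convergent_iff convergent_def by blast
  have KG: "norm (K - G x) \<le> - \<phi> x" for x
  proof (rule tendsto_upperbound)
    show "(\<lambda>n. norm (G (real n) - G x)) \<longlonglongrightarrow> norm (K - G x)"
      by (intro tendsto_intros K)
    show "\<forall>\<^sub>F n in sequentially. norm (G (real n) - G x) \<le> - \<phi> x"
      using eventually_ge_at_top[of "nat \<lceil>x\<rceil>"]
      by eventually_elim (auto intro!: tail simp: nat_le_iff ceiling_le_iff)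
  qed simp
  define v where "v x = exp (\<mu> * of_real x) *\<^sub>C (K - G x)" for x
  show ?thesis
  proof
    fix s
    have "((\<lambda>x. K - G x) has_vector_derivative - (exp ((-\<mu>) * of_real s) *\<^sub>C f s)) (at (0 + s))"
      using G'[of s] by (auto intro!: derivative_eq_intros)
    from has_vector_derivative_exp_scaleC[OF this, of \<mu>]
    have "(v has_vector_derivative exp (\<mu> * of_real s) *\<^sub>C
        (\<mu> *\<^sub>C (K - G s) + - (exp ((-\<mu>) * of_real s) *\<^sub>C f s))) (at s)"
      by (simp add: v_def[abs_def])
    also have "exp (\<mu> * of_real s) *\<^sub>C
        (\<mu> *\<^sub>C (K - G s) + - (exp ((-\<mu>) * of_real s) *\<^sub>C f s)) = \<mu> *\<^sub>C v s - f s"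
      by (simp only: v_def scaleC_add_right scaleC.minus_right scaleC_scaleC flip: exp_add)
         (simp add: mult.commute)
    finally show "(v has_vector_derivative \<mu> *\<^sub>C v s - f s) (at s)" .
    have "norm (v s) \<le> exp (Re \<mu> * s) * - \<phi> s"
      using mult_left_mono[OF KG[of s], of "exp (Re \<mu> * s)"] by (simp add: v_def norm_scaleC)
    also have "\<dots> = B / Re \<mu>"
      by (simp add: \<phi>_def exp_minus)
    finally show "norm (v s) \<le> B / Re \<mu>" .
  qed
qed

lemma reflect_has_vector_derivative:
  assumes "(v has_vector_derivative v') (at (- s))"
  shows "((\<lambda>s. v (- s)) has_vector_derivative - v') (at (s::real))"
proof -
  have "((\<lambda>s. v (- s)) has_vector_derivative (- 1) *\<^sub>R v') (at s)"
    by (rule vector_diff_chain_at[where f = uminus, unfolded o_def])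
       (auto intro!: derivative_eq_intros assms)
  then show ?thesis
    by simp
qed

lemma diff_resolvent_equation_has_integral:
  fixes v :: "real \<Rightarrow>\<^sub>C 'a::complex_banach"
  assumes "v \<in> diff_dom" and "\<mu> *\<^sub>C v - diff_op v = u"
  shows "Re \<mu> > 0 \<Longrightarrow>
      ((\<lambda>t. exp (- (\<mu> * of_real t)) *\<^sub>C u (\<xi> + t)) has_integral v \<xi>) {0..}" (is "_ \<Longrightarrow> ?P")
    and "Re \<mu> < 0 \<Longrightarrow>
      ((\<lambda>t. exp (\<mu> * of_real t) *\<^sub>C u (\<xi> - t)) has_integral - v \<xi>) {0..}" (is "_ \<Longrightarrow> ?N")
proof -
  have v': "(apply_bcontfun v has_vector_derivative \<mu> *\<^sub>C v s - u s) (at s)" for s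
    using has_vector_derivative_diff_op[OF assms(1), of s] by (simp flip: assms(2))
  show ?P if "Re \<mu> > 0"
    using bounded_solution_has_integral[OF that v', of "norm v"] by (simp add: norm_bounded)
  show ?N if "Re \<mu> < 0"
  proof -
    have "((\<lambda>s. v (- s)) has_vector_derivative (-\<mu>) *\<^sub>C v (- s) - (- u (- s))) (at s)" for s
      using reflect_has_vector_derivative[OF v'[of "- s"]] by (simp add: scaleC.minus_left)
    from bounded_solution_has_integral[OF _ this, of "norm v" "- \<xi>"]
    have "((\<lambda>t. - (exp (\<mu> * of_real t) *\<^sub>C u (\<xi> - t))) has_integral v \<xi>) {0..}"
      using that by (simp add: norm_bounded scaleC.minus_right)
    from has_integral_neg[OF this] show ?thesis
      by simp
  qed
qed

text \<open>\<open>\<mu> - D\<close> is a bijection from the domain of \<open>D\<close> onto the whole space, so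
  \<^const>\<open>diff_resolvent\<close> is its genuine two-sided inverse; it has the expected integral
  representation.\<close>

theorem bij_betw_lambda_minus_diff_op:
  assumes "Re \<mu> \<noteq> 0"
  shows "bij_betw (\<lambda>v. \<mu> *\<^sub>C v - diff_op v) diff_dom (UNIV :: (real \<Rightarrow>\<^sub>C 'a::complex_banach) set)"
proof (rule bij_betw_imageI)
  show "inj_on (\<lambda>v. \<mu> *\<^sub>C v - diff_op v) (diff_dom :: (real \<Rightarrow>\<^sub>C 'a) set)"
  proof (rule inj_onI, rule bcontfun_eqI)
    fix v w :: "real \<Rightarrow>\<^sub>C 'a" and x
    assume v: "v \<in> diff_dom" and w: "w \<in> diff_dom"
      and eq: "\<mu> *\<^sub>C v - diff_op v = \<mu> *\<^sub>C w - diff_op w"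
    show "apply_bcontfun v x = apply_bcontfun w x"
    proof (cases "Re \<mu> > 0")
      case True
      show ?thesis
        using has_integral_unique[OF diff_resolvent_equation_has_integral(1)[OF v eq True]
            diff_resolvent_equation_has_integral(1)[OF w refl True]] .
    next
      case False
      then have "Re \<mu> < 0"
        using assms by simp
      then show ?thesis
        using has_integral_unique[OF diff_resolvent_equation_has_integral(2)[OF v eq]
            diff_resolvent_equation_has_integral(2)[OF w refl], of x] by simp
    qed
  qed
  have "u \<in> (\<lambda>v. \<mu> *\<^sub>C v - diff_op v) ` diff_dom" for u :: "real \<Rightarrow>\<^sub>C 'a"
  proof -
    obtain v B where v': "\<And>s. (v has_vector_derivative \<mu> *\<^sub>C v s - u s) (at s)"
      and bound: "\<And>s. norm (v s) \<le> B"
    proof (cases "Re \<mu> > 0")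
      case True
      show ?thesis
        by (rule bounded_solution_exists[OF True, of u "norm u"]) (auto simp: norm_bounded intro: that)
    next
      case False
      then have neg: "Re (- \<mu>) > 0"
        using assms by simp
      have "continuous_on UNIV (\<lambda>s. - u (- s))"
        by (rule continuous_on_minus, rule continuous_on_compose2[of UNIV u UNIV uminus])
           (auto intro: continuous_on_minus)
      then obtain w where
        w': "\<And>s. (w has_vector_derivative (-\<mu>) *\<^sub>C w s - (- u (- s))) (at s)" and
        bound: "\<And>s. norm (w s) \<le> norm u / Re (- \<mu>)"
        by (rule bounded_solution_exists[OF neg, of "\<lambda>s. - u (- s)" "norm u"])
           (simp only: norm_minus_cancel norm_bounded, blast)
      show ?thesis
      proof (rule that)
        show "((\<lambda>s. w (- s)) has_vector_derivative \<mu> *\<^sub>C w (- s) - u s) (at s)" for s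
          using reflect_has_vector_derivative[OF w'[of "- s"]] by (simp add: scaleC.minus_left)
      qed (rule bound)
    qed
    have "v \<in> bcontfun"
      using v' bound
      by (intro bcontfun_normI[where b = B])
         (auto intro!: continuous_at_imp_continuous_on has_vector_derivative_continuous)
    then obtain V where V: "v = apply_bcontfun V"
      by (rule bcontfunE)
    have V': "(apply_bcontfun V has_vector_derivative (\<mu> *\<^sub>C V - u) s) (at s)" for s
      using v'[of s] by (simp add: V)
    have "V \<in> diff_dom"
      unfolding diff_dom_def using V' by blast
    moreover have "u = \<mu> *\<^sub>C V - diff_op V"
      using diff_op_eqI[OF V'] by simp
    ultimately show ?thesis
      by blast
  qed
  then show "(\<lambda>v. \<mu> *\<^sub>C v - diff_op v) ` diff_dom = (UNIV :: (real \<Rightarrow>\<^sub>C 'a) set)"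
    by blast
qed

lemma diff_resolvent_in_dom: "Re \<mu> \<noteq> 0 \<Longrightarrow> diff_resolvent \<mu> u \<in> diff_dom"
  and diff_resolvent_right_inverse:
    "Re \<mu> \<noteq> 0 \<Longrightarrow> \<mu> *\<^sub>C diff_resolvent \<mu> u - diff_op (diff_resolvent \<mu> u) = u"
  unfolding diff_resolvent_def
  using bij_betw_lambda_minus_diff_op[of \<mu>, where 'a = 'a]
  by (auto simp: bij_betw_def intro!: inv_into_into
      f_inv_into_f[of u "\<lambda>v. \<mu> *\<^sub>C v - diff_op v" diff_dom])

theorem diff_resolvent_eq_integral:
  fixes u :: "real \<Rightarrow>\<^sub>C 'a::complex_banach"
  shows "Re \<mu> > 0 \<Longrightarrow>
      diff_resolvent \<mu> u \<xi> = integral {0..} (\<lambda>t. exp (- (\<mu> * of_real t)) *\<^sub>C u (\<xi> + t))"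
    and "Re \<mu> < 0 \<Longrightarrow>
      diff_resolvent \<mu> u \<xi> = - integral {0..} (\<lambda>t. exp (\<mu> * of_real t) *\<^sub>C u (\<xi> - t))"
proof -
  show "diff_resolvent \<mu> u \<xi> = integral {0..} (\<lambda>t. exp (- (\<mu> * of_real t)) *\<^sub>C u (\<xi> + t))"
    if "Re \<mu> > 0"
    using diff_resolvent_equation_has_integral(1)[OF diff_resolvent_in_dom
        diff_resolvent_right_inverse, of \<mu> u \<xi>] that by (simp add: integral_unique)
  show "diff_resolvent \<mu> u \<xi> = - integral {0..} (\<lambda>t. exp (\<mu> * of_real t) *\<^sub>C u (\<xi> - t))"
    if "Re \<mu> < 0"
    using diff_resolvent_equation_has_integral(2)[OF diff_resolvent_in_dom
        diff_resolvent_right_inverse, of \<mu> u \<xi>] that by (simp add: integral_unique)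
qed


section \<open>Schwartz functions and the Beurling spectrum\<close>

abbreviation iter_deriv :: "nat \<Rightarrow> (real \<Rightarrow> complex) \<Rightarrow> real \<Rightarrow> complex"
  where "iter_deriv k \<phi> \<equiv> ((\<lambda>f t. vector_derivative f (at t)) ^^ k) \<phi>"

definition schwartz :: "(real \<Rightarrow> complex) set"
  where "schwartz = {\<phi>. (\<forall>k t. iter_deriv k \<phi> differentiable (at t)) \<and>
    (\<forall>m k. bounded (range (\<lambda>t. of_real (t ^ m) * iter_deriv k \<phi> t)))}"

definition fourier :: "(real \<Rightarrow> complex) \<Rightarrow> real \<Rightarrow> complex"
  where "fourier \<phi> s = (LINT t|lborel. exp (- (\<i> * of_real (s * t))) * \<phi> t)"

text \<open>The Bochner integral of the library is restricted to separable spaces, hence the use of the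
  Henstock--Kurzweil integral for vector-valued integrands.  For the continuous, absolutely
  integrable functions at hand the two notions agree; see \<open>convolution_integrable\<close> below.\<close>

definition convolution :: "(real \<Rightarrow> complex) \<Rightarrow> (real \<Rightarrow>\<^sub>C 'a::complex_banach) \<Rightarrow> real \<Rightarrow> 'a"
  where "convolution \<phi> u s = integral UNIV (\<lambda>t. \<phi> (s - t) *\<^sub>C u t)"

definition beurling_spectrum :: "(real \<Rightarrow>\<^sub>C 'a::complex_banach) \<Rightarrow> real set"
  where "beurling_spectrum u = {\<xi>. \<forall>\<epsilon>>0. \<exists>\<phi>\<in>schwartz.
    closure {s. fourier \<phi> s \<noteq> 0} \<subseteq> {\<xi> - \<epsilon><..<\<xi> + \<epsilon>} \<and> (\<exists>s. convolution \<phi> u s \<noteq> 0)}"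

lemma inverse_square_integrable: "(\<lambda>t::real. inverse (1 + (t - s)\<^sup>2)) integrable_on UNIV"
proof -
  let ?f = "\<lambda>t::real. inverse (1 + (t - s)\<^sup>2)"
  have int: "(?f has_integral arctan (b - s) - arctan (a - s)) {a..b}" if "a \<le> b" for a b
    using that
    by (intro fundamental_theorem_of_calculus)
       (auto intro!: derivative_eq_intros simp flip: has_real_derivative_iff_has_vector_derivative)
  have "\<exists>B>0. \<forall>a b. ball 0 B \<subseteq> cbox a b \<longrightarrow>
      (\<exists>z. (?f has_integral z) (cbox a b) \<and> norm (z - pi) < e)" if "e > 0" for e
  proof -
    obtain M where M: "\<And>x. x \<ge> M \<Longrightarrow> dist (arctan x) (pi / 2) < e / 2"
      using tendstoD[OF tendsto_arctan_at_top, of "e / 2"] \<open>e > 0\<close>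
      by (auto simp: eventually_at_top_linorder)
    show ?thesis
    proof (rule exI[of _ "\<bar>M\<bar> + \<bar>s\<bar> + 1"], intro conjI allI impI)
      fix a b :: real
      assume sub: "ball 0 (\<bar>M\<bar> + \<bar>s\<bar> + 1) \<subseteq> cbox a b"
      have "- (\<bar>M\<bar> + \<bar>s\<bar>) \<in> cbox a b" "\<bar>M\<bar> + \<bar>s\<bar> \<in> cbox a b"
        by (rule subsetD[OF sub]; simp)+
      then have ab: "a \<le> - (\<bar>M\<bar> + \<bar>s\<bar>)" "\<bar>M\<bar> + \<bar>s\<bar> \<le> b"
        by auto
      have "norm (arctan (b - s) - arctan (a - s) - pi) < e"
        using M[of "b - s"] M[of "s - a"] ab arctan_minus[of "s - a"]
        by (simp add: dist_real_def abs_if split: if_splits)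
      then show "\<exists>z. (?f has_integral z) (cbox a b) \<and> norm (z - pi) < e"
        using int[of a b] ab by (intro exI[of _ "arctan (b - s) - arctan (a - s)"]) auto
    qed auto
  qed
  moreover have "\<nexists>a b. (UNIV :: real set) = cbox a b"
    by (metis bounded_cbox not_bounded_UNIV)
  ultimately have "(?f has_integral pi) UNIV"
    by (subst has_integral_alt) auto
  then show ?thesis
    by blast
qed

lemma convolution_integrable:
  fixes u :: "real \<Rightarrow>\<^sub>C 'a::complex_banach"
  assumes "\<phi> \<in> schwartz"
  shows "(\<lambda>t. \<phi> (s - t) *\<^sub>C u t) integrable_on UNIV"
    and "(\<lambda>t. norm (\<phi> (s - t) *\<^sub>C u t)) integrable_on UNIV"
proof -
  have "\<phi> differentiable (at t)" for t
    using assms by (auto simp: schwartz_def dest: spec[of _ 0])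
  then have cont: "continuous_on S \<phi>" for S
    by (intro continuous_at_imp_continuous_on ballI differentiable_imp_continuous_within)
  have "\<exists>B. \<forall>t. norm (of_real (t ^ m) * \<phi> t) \<le> B" for m
  proof -
    have "bounded (range (\<lambda>t. of_real (t ^ m) * iter_deriv 0 \<phi> t))"
      using assms unfolding schwartz_def by blast
    then show ?thesis
      by (auto simp: bounded_iff)
  qed
  from this[of 0] this[of 2] obtain B0 B2 where
    B: "\<And>t. cmod (\<phi> t) \<le> B0" "\<And>t. t\<^sup>2 * cmod (\<phi> t) \<le> B2"
    by (auto simp: norm_mult norm_power)
  have "cmod (\<phi> t) \<le> (B0 + B2) * inverse (1 + t\<^sup>2)" for t
  proof -
    have "1 + t\<^sup>2 > 0"
      by (rule add_pos_nonneg) auto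
    then show ?thesis
      using add_mono[OF B(1)[of t] B(2)[of t]] by (simp add: field_simps)
  qed
  then have le: "norm (\<phi> (s - t) *\<^sub>C u t) \<le> (B0 + B2) * inverse (1 + (t - s)\<^sup>2) * norm u" for t
    unfolding norm_scaleC power2_commute[of t s]
    by (intro mult_mono norm_bounded) (auto intro: order_trans[OF norm_ge_zero])
  have int: "(\<lambda>t. (B0 + B2) * inverse (1 + (t - s)\<^sup>2) * norm u) integrable_on UNIV"
    by (intro integrable_on_mult_left integrable_on_mult_right inverse_square_integrable)
  have cont': "continuous_on S (\<lambda>t. \<phi> (s - t) *\<^sub>C u t)" for S
    by (intro continuous_intros continuous_on_compose2[OF cont[of UNIV]]) auto
  show "(\<lambda>t. \<phi> (s - t) *\<^sub>C u t) integrable_on UNIV"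
    by (rule integrable_on_all_intervals_integrable_bound[OF _ le int])
       (simp add: integrable_continuous_real cont')
  show "(\<lambda>t. norm (\<phi> (s - t) *\<^sub>C u t)) integrable_on UNIV"
    by (rule integrable_on_all_intervals_integrable_bound[OF _ _ int])
       (use le in \<open>simp_all add: integrable_continuous_real cont' continuous_on_norm\<close>)
qed


section \<open>The supremum of \<open>1 / |\<mu> - i\<xi>|\<close>\<close>

definition sup0 :: "real set \<Rightarrow> real"
  where "sup0 A = (if A = {} then 0 else Sup A)"

lemma bdd_above_inverse_dist_imaginary_axis:
  assumes "Re \<mu> \<noteq> 0"
  shows "bdd_above {inverse (cmod (\<mu> - \<i> * of_real \<xi>)) | \<xi>. \<xi> \<in> A}"
proof (rule bdd_aboveI)
  fix x assume "x \<in> {inverse (cmod (\<mu> - \<i> * of_real \<xi>)) | \<xi>. \<xi> \<in> A}"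
  then obtain \<xi> where x: "x = inverse (cmod (\<mu> - \<i> * of_real \<xi>))"
    by blast
  have "\<bar>Re \<mu>\<bar> \<le> cmod (\<mu> - \<i> * of_real \<xi>)"
    using abs_Re_le_cmod[of "\<mu> - \<i> * of_real \<xi>"] by simp
  then show "x \<le> inverse \<bar>Re \<mu>\<bar>"
    using assms unfolding x by (intro le_imp_inverse_le) auto
qed

end

(* If w = (mu - D) v and the test function g is the Fourier transform of phi, integration by parts gives
   phi * w = psi * v, where psi has Fourier transform (mu - i xi) g. Iterating, phi * u = phi_n * R^n u,
   where R is the resolvent and phi_n has Fourier transform (mu - i xi)^n g. Two derivatives of the
   symbol bound the L1 norm of phi_n by O(n^2) sup |mu - i xi|^n over the support of g.

   Lower bound: for xi in the spectrum choose phi with phi * u nonzero and g supported near xi.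
   Upper bound: if kappa is a test function that is 1 near the compact spectrum and phi is its inverse
   transform, then R^n u = phi * R^n u = psi_n * u, where psi_n has Fourier transform
   (mu - i xi)^(-n) kappa. The first equality holds because a test function supported off the
   spectrum gives convolution 0 with u (partition of unity), and the dilations theta(xi / k), whose
   inverse transforms form an approximate identity, differ from kappa by such a function. *)

theory Submission
  imports "HOL-Probability.Characteristic_Functions" Defs
begin


text \<open>The spectrum is defined through Schwartz functions with band-limited transform, while
  all estimates concern symbols. Fourier inversion therefore has to work both ways: the inverse
  transform of a test function is Schwartz with the prescribed transform, and a band-limited
  Schwartz function is the inverse transform of its own transform. Every operator identity is turned
  into an identity between symbols under a single convolution. In particular the spectrum of
  \<open>(diff_resolvent \<mu> ^^ n) u\<close> never has to be compared with that of
  \<open>u\<close>: dividing the symbol by an n-th power brings the convolution back to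
  \<open>u\<close>. Both bounds rest on one decay estimate, applied to the symbol for the lower
  bound and to its reciprocal for the upper one; its polynomial loss disappears under the n-th root.
  Compactness of the spectrum enters because only a bounded set has a compactly supported cutoff
  equal to 1 near it, and because a compact set keeps a positive distance from the complement of an
  open set around it. Vector-valued integrals are estimated by scalar majorants, where Lebesgue
  theory applies.\<close>

section \<open>Smooth functions and partitions of unity\<close>

text \<open>The derivative is existentially quantified, so closure under sums, products and
  reciprocals is shown by exhibiting a candidate derivative one order lower.\<close>

primrec cdiff :: "nat \<Rightarrow> (real \<Rightarrow> complex) \<Rightarrow> bool" where
  "cdiff 0 f = continuous_on UNIV f"
| "cdiff (Suc k) f = (\<exists>f'. (\<forall>t. (f has_vector_derivative f' t) (at t)) \<and> cdiff k f')"

definition smooth :: "(real \<Rightarrow> complex) \<Rightarrow> bool"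
  where "smooth f \<longleftrightarrow> (\<forall>k. cdiff k f)"

lemma continuous_on_has_vector_derivative:
  "(\<And>t. (f has_vector_derivative f' t) (at t)) \<Longrightarrow> continuous_on S f"
  by (meson continuous_at_imp_continuous_on has_vector_derivative_continuous)

lemma cdiff_SucI:
  "(\<And>t. (f has_vector_derivative f' t) (at t)) \<Longrightarrow> cdiff k f' \<Longrightarrow> cdiff (Suc k) f"
  by auto

lemma cdiff_SucD: "cdiff (Suc k) f \<Longrightarrow> cdiff k f"
proof (induction k arbitrary: f)
  case 0
  then show ?case by (auto intro: continuous_on_has_vector_derivative)
next
  case (Suc k)
  from Suc.prems obtain f' where "\<And>t. (f has_vector_derivative f' t) (at t)" "cdiff (Suc k) f'"
    unfolding cdiff.simps(2)[of "Suc k"] by blast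
  with Suc.IH[of f'] show ?case unfolding cdiff.simps(2)[of k f] by blast
qed

text \<open>\<open>cdiff (Suc k) f\<close> supplies a derivative that may a priori depend on
  \<open>k\<close>. Uniqueness of derivatives on the real line makes all of them equal, so one
  function serves every order.\<close>

lemma smooth_derivE:
  assumes "smooth f"
  obtains f' where "\<And>t. (f has_vector_derivative f' t) (at t)" "smooth f'"
proof -
  have *: "\<exists>f'. (\<forall>t. (f has_vector_derivative f' t) (at t)) \<and> cdiff k f'" for k
    using assms unfolding smooth_def cdiff.simps(2)[symmetric] by blast
  then obtain f' where f': "\<And>t. (f has_vector_derivative f' t) (at t)" by blast
  have "cdiff k f'" for k
  proof -
    obtain g where g: "\<And>t. (f has_vector_derivative g t) (at t)" "cdiff k g"
      using *[of k] by blast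
    have "f' = g"
      using vector_derivative_unique_at[OF f' g(1)] by blast
    with g show ?thesis by simp
  qed
  with f' that show ?thesis by (auto simp: smooth_def)
qed

lemma smoothI:
  assumes "\<And>t. (f has_vector_derivative f' t) (at t)" "smooth f'"
  shows "smooth f"
  unfolding smooth_def
proof
  fix k show "cdiff k f"
  proof (rule cdiff_SucD)
    show "cdiff (Suc k) f" using assms by (auto simp: smooth_def)
  qed
qed

lemma smooth_continuous: "smooth f \<Longrightarrow> continuous_on S f"
  unfolding smooth_def by (metis cdiff.simps(1) continuous_on_subset subset_UNIV)

lemma cdiff_const: "cdiff k (\<lambda>_. c)"
  by (induction k arbitrary: c) (auto intro!: exI[of _ "\<lambda>_. 0"])

lemma smooth_const [simp]: "smooth (\<lambda>_. c)"
  by (simp add: smooth_def cdiff_const)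

lemma smooth_of_real: "smooth of_real"
  by (rule smoothI[OF _ smooth_const[of 1]]) (auto intro!: derivative_eq_intros)

lemma cdiff_add: "cdiff k f \<Longrightarrow> cdiff k g \<Longrightarrow> cdiff k (\<lambda>x. f x + g x)"
proof (induction k arbitrary: f g)
  case (Suc k)
  then obtain f' g' where
    d: "\<And>t. (f has_vector_derivative f' t) (at t)" "cdiff k f'"
    "\<And>t. (g has_vector_derivative g' t) (at t)" "cdiff k g'"
    by auto
  have "cdiff k (\<lambda>x. f' x + g' x)"
    by (intro Suc.IH d)
  moreover have "((\<lambda>x. f x + g x) has_vector_derivative f' t + g' t) (at t)" for t
    by (intro has_vector_derivative_add d)
  ultimately show ?case by (intro cdiff_SucI)
qed (auto intro: continuous_on_add)

lemma cdiff_mult: "cdiff k f \<Longrightarrow> cdiff k g \<Longrightarrow> cdiff k (\<lambda>x. f x * g x)"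
proof (induction k arbitrary: f g)
  case (Suc k)
  then obtain f' g' where
    d: "\<And>t. (f has_vector_derivative f' t) (at t)" "cdiff k f'"
    "\<And>t. (g has_vector_derivative g' t) (at t)" "cdiff k g'"
    by auto
  have "cdiff k (\<lambda>x. f x * g' x + f' x * g x)"
    using Suc.prems by (intro cdiff_add Suc.IH[OF cdiff_SucD d(4)] Suc.IH[OF d(2) cdiff_SucD])
  then show ?case
    by (rule cdiff_SucI[OF has_vector_derivative_mult[OF d(1,3)]])
qed (auto intro: continuous_on_mult)

text \<open>The derivative of \<open>1 / f\<close> contains \<open>1 / f\<close> itself, which the
  induction hypothesis controls at order \<open>k\<close>.\<close>

lemma cdiff_inverse:
  "cdiff k f \<Longrightarrow> (\<And>x. f x \<noteq> 0) \<Longrightarrow> cdiff k (\<lambda>x. inverse (f x))"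
proof (induction k)
  case (Suc k)
  then obtain f' where d: "\<And>t. (f has_vector_derivative f' t) (at t)" "cdiff k f'"
    by auto
  have inv: "cdiff k (\<lambda>x. inverse (f x))"
    by (rule Suc.IH[OF cdiff_SucD[OF Suc.prems(1)] Suc.prems(2)])
  have "cdiff k (\<lambda>x. - 1 * (inverse (f x) * f' x * inverse (f x)))"
    by (rule cdiff_mult[OF cdiff_const cdiff_mult[OF cdiff_mult[OF inv d(2)] inv]])
  moreover have "((\<lambda>x. inverse (f x)) has_vector_derivative
      - 1 * (inverse (f t) * f' t * inverse (f t))) (at t)" for t
    using Deriv.has_derivative_inverse[OF Suc.prems(2)[of t] d(1)[of t, unfolded has_vector_derivative_def]]
    unfolding has_vector_derivative_def by (simp add: algebra_simps)
  ultimately show ?case by (intro cdiff_SucI)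
qed (auto intro: continuous_on_inverse)

lemma smooth_add: "smooth f \<Longrightarrow> smooth g \<Longrightarrow> smooth (\<lambda>x. f x + g x)"
  and smooth_mult: "smooth f \<Longrightarrow> smooth g \<Longrightarrow> smooth (\<lambda>x. f x * g x)"
  and smooth_inverse: "smooth f \<Longrightarrow> (\<And>x. f x \<noteq> 0) \<Longrightarrow> smooth (\<lambda>x. inverse (f x))"
  by (simp_all add: smooth_def cdiff_add cdiff_mult cdiff_inverse)

lemma smooth_diff: "smooth f \<Longrightarrow> smooth g \<Longrightarrow> smooth (\<lambda>x. f x - g x)"
  using smooth_add[OF _ smooth_mult[OF smooth_const[of "-1"]]] by simp

lemma smooth_power: "smooth f \<Longrightarrow> smooth (\<lambda>x. f x ^ n)"
  by (induction n) (auto intro: smooth_mult)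

lemma smooth_sum: "(\<And>j. j \<in> I \<Longrightarrow> smooth (f j)) \<Longrightarrow> smooth (\<lambda>x. \<Sum>j\<in>I. f j x)"
  by (induction I rule: infinite_finite_induct) (auto intro: smooth_add)

lemma cdiff_affine: "cdiff k f \<Longrightarrow> cdiff k (\<lambda>x. f (a * x + b))"
proof (induction k arbitrary: f)
  case 0
  then show ?case
    by (auto intro!: continuous_on_compose2[of UNIV f] continuous_intros)
next
  case (Suc k)
  then obtain f' where d: "\<And>t. (f has_vector_derivative f' t) (at t)" "cdiff k f'"
    by auto
  have "((\<lambda>x. f (a * x + b)) has_vector_derivative of_real a * f' (a * t + b)) (at t)" for t
  proof -
    have "((\<lambda>x. a * x + b) has_vector_derivative a) (at t)"
      by (auto intro!: derivative_eq_intros)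
    from vector_diff_chain_at[OF this d(1)] show ?thesis
      by (simp add: o_def scaleR_conv_of_real)
  qed
  moreover have "cdiff k (\<lambda>x. of_real a * f' (a * x + b))"
    by (rule cdiff_mult[OF cdiff_const Suc.IH[OF d(2)]])
  ultimately show ?case by (intro cdiff_SucI)
qed

lemma smooth_affine: "smooth f \<Longrightarrow> smooth (\<lambda>x. f (a * x + b))"
  by (simp add: smooth_def cdiff_affine)

section \<open>A smooth step function and partitions of unity made from its translates\<close>

definition flat_exp :: "real poly \<Rightarrow> real \<Rightarrow> real"
  where "flat_exp p x = (if x > 0 then poly p (inverse x) * exp (- inverse x) else 0)"

lemma poly_exp_tendsto_0: "((\<lambda>y::real. poly p y * exp (- y)) \<longlongrightarrow> 0) at_top"
proof -
  have "((\<lambda>y. \<Sum>i\<le>degree p. coeff p i * (y ^ i / exp y)) \<longlongrightarrow> (\<Sum>i\<le>degree p. coeff p i * 0)) at_top"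
    by (intro tendsto_intros tendsto_power_div_exp_0)
  then show ?thesis
    by (simp add: poly_altdef sum_distrib_right exp_minus divide_inverse mult.assoc)
qed

text \<open>The polynomial makes the family closed under differentiation: for positive
  \<open>x\<close> the derivative of \<open>p(1/x) exp(-1/x)\<close> is
  \<open>x^(-2) (p - p')(1/x) exp(-1/x)\<close>, and the two \<open>pCons 0\<close> are the factor
  \<open>x^(-2)\<close>.\<close>

lemma flat_exp_deriv:
  "(flat_exp p has_vector_derivative flat_exp (pCons 0 (pCons 0 (p - pderiv p))) x) (at x)"
proof -
  consider "x > 0" | "x < 0" | "x = 0" by linarith
  then show ?thesis
  proof cases
    case 1
    have "((\<lambda>x. poly p (inverse x) * exp (- inverse x)) has_vector_derivative
        flat_exp (pCons 0 (pCons 0 (p - pderiv p))) x) (at x)"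
      using 1 unfolding has_real_derivative_iff_has_vector_derivative[symmetric]
      by (auto intro!: derivative_eq_intros DERIV_chain2[OF poly_DERIV]
          simp: flat_exp_def algebra_simps power2_eq_square)
    then show ?thesis
      by (rule has_vector_derivative_transform_within_open[where S = "{0<..}"])
         (use 1 in \<open>auto simp: flat_exp_def\<close>)
  next
    case 2
    show ?thesis
      by (rule has_vector_derivative_transform_within_open[where S = "{..<0}" and f = "\<lambda>_. 0"])
         (use 2 in \<open>auto simp: flat_exp_def\<close>)
  next
    case 3
    \<comment> \<open>Dividing by \<open>h\<close> multiplies the polynomial in \<open>1/h\<close>
      by its variable, so the difference quotient at 0 is again a polynomial in \<open>1/h\<close>
      that the exponential beats.\<close>
    have "((\<lambda>h. (poly (pCons 0 p) (inverse h) * exp (- inverse h))) \<longlongrightarrow> 0) (at_right 0)"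
      by (rule filterlim_compose[OF poly_exp_tendsto_0 filterlim_inverse_at_top_right])
    moreover have "\<forall>\<^sub>F h in at_right 0. poly (pCons 0 p) (inverse h) * exp (- inverse h) = flat_exp p h / h"
      by (rule eventually_mono[OF eventually_at_right_less[of 0]]) (auto simp: flat_exp_def field_simps)
    ultimately have "((\<lambda>h. flat_exp p h / h) \<longlongrightarrow> 0) (at_right 0)"
      by (rule Lim_transform_eventually)
    moreover have "((\<lambda>h. flat_exp p h / h) \<longlongrightarrow> 0) (at_left 0)"
      by (rule Lim_transform_eventually[OF tendsto_const])
         (rule eventually_at_leftI[of "-1"], auto simp: flat_exp_def)
    ultimately have "((\<lambda>h. flat_exp p h / h) \<longlongrightarrow> 0) (at 0)"
      by (simp add: filterlim_at_split)
    then show ?thesis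
      using 3 unfolding has_real_derivative_iff_has_vector_derivative[symmetric] DERIV_def
      by (simp add: flat_exp_def)
  qed
qed

lemma smooth_flat_exp: "smooth (\<lambda>x. of_real (flat_exp p x))"
proof -
  have d: "((\<lambda>x. of_real (flat_exp p x)) has_vector_derivative
      complex_of_real (flat_exp (pCons 0 (pCons 0 (p - pderiv p))) x)) (at x)" for x p
    using bounded_linear.has_vector_derivative[OF bounded_linear_of_real flat_exp_deriv] .
  have "cdiff k (\<lambda>x. complex_of_real (flat_exp p x))" for k
  proof (induction k arbitrary: p)
    case 0
    show ?case using continuous_on_has_vector_derivative[OF d] by simp
  next
    case (Suc k)
    show ?case by (rule cdiff_SucI[OF d Suc])
  qed
  then show ?thesis by (simp add: smooth_def)
qed

text \<open>With \<open>f\<close> zero up to 0 and positive to the right of it, the step is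
  \<open>f(x) / (f(x) + f(1 - x))\<close>. The denominator never vanishes because \<open>x\<close>
  or \<open>1 - x\<close> is positive.\<close>

lemma smooth_step_exists:
  obtains \<sigma> :: "real \<Rightarrow> complex" where "smooth \<sigma>" "\<And>x. x \<le> 0 \<Longrightarrow> \<sigma> x = 0" "\<And>x. x \<ge> 1 \<Longrightarrow> \<sigma> x = 1"
proof
  define f where "f x = complex_of_real (flat_exp 1 x)" for x
  define g where "g x = f x + f (- 1 * x + 1)" for x
  have "smooth f" unfolding f_def by (rule smooth_flat_exp)
  moreover from this have "smooth g"
    unfolding g_def by (intro smooth_add smooth_affine)
  moreover have "g x \<noteq> 0" for x
  proof -
    have nn: "flat_exp 1 y \<ge> 0" "y > 0 \<Longrightarrow> flat_exp 1 y > 0" for y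
      by (auto simp: flat_exp_def)
    have "flat_exp 1 x + flat_exp 1 (1 - x) > 0"
      using nn(1)[of x] nn(1)[of "1 - x"] nn(2)[of x] nn(2)[of "1 - x"] by (cases "x > 0") auto
    then show ?thesis
      by (auto simp: g_def f_def simp flip: of_real_add)
  qed
  ultimately show "smooth (\<lambda>x. f x * inverse (g x))"
    by (intro smooth_mult smooth_inverse)
  show "f x * inverse (g x) = 0" if "x \<le> 0" for x
    using that by (simp add: f_def flat_exp_def)
  show "f x * inverse (g x) = 1" if "x \<ge> 1" for x
    using that by (simp add: f_def g_def flat_exp_def)
qed

text \<open>The pieces are differences of consecutive translates of one step function, so their sum
  telescopes.\<close>

lemma smooth_partition:
  fixes \<delta> A :: real
  assumes "\<delta> > 0"
  obtains n :: nat and h c where "\<And>j. smooth (h j)"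
    and "\<And>j s. h j s \<noteq> 0 \<Longrightarrow> \<bar>s - c j\<bar> \<le> \<delta>"
    and "\<And>s. \<bar>s\<bar> \<le> A \<Longrightarrow> (\<Sum>j<n. h j s) = 1"
proof -
  obtain \<sigma> :: "real \<Rightarrow> complex" where \<sigma>: "smooth \<sigma>" "\<And>x. x \<le> 0 \<Longrightarrow> \<sigma> x = 0" "\<And>x. x \<ge> 1 \<Longrightarrow> \<sigma> x = 1"
    by (rule smooth_step_exists) blast
  \<comment> \<open>\<open>H j\<close> passes from 0 to 1 between
    \<open>\<delta> j - |A| - \<delta>\<close> and \<open>\<delta> j - |A|\<close>, so
    \<open>H j - H (j + 1)\<close> lives within distance \<open>\<delta>\<close> of the centre
    \<open>\<delta> j - |A|\<close>.\<close>
  define H where "H j s = \<sigma> ((1 / \<delta>) * s + ((\<bar>A\<bar> + \<delta>) / \<delta> - real j))" for j s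
  \<comment> \<open>This many pieces reach past the right end: on \<open>[-A, A]\<close> the first
    step \<open>H 0\<close> is 1 and \<open>H n\<close> is 0.\<close>
  obtain n :: nat where n: "2 * \<bar>A\<bar> / \<delta> + 1 \<le> real n"
    using real_arch_simple by blast
  show ?thesis
  proof (rule that[of "\<lambda>j s. H j s - H (Suc j) s" "\<lambda>j. \<delta> * real j - \<bar>A\<bar>" n])
    show "smooth (\<lambda>s. H j s - H (Suc j) s)" for j
      unfolding H_def by (intro smooth_diff smooth_affine \<sigma>)
    show "\<bar>s - (\<delta> * real j - \<bar>A\<bar>)\<bar> \<le> \<delta>" if "H j s - H (Suc j) s \<noteq> 0" for j s
    proof (rule ccontr)
      assume "\<not> ?thesis"
      then consider "s + \<bar>A\<bar> + \<delta> \<le> \<delta> * real j" | "s + \<bar>A\<bar> + \<delta> \<ge> \<delta> * (real j + 2)"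
        by (auto simp: abs_if algebra_simps split: if_splits)
      then have "H j s - H (Suc j) s = 0"
      proof cases
        case 1
        then have "(1 / \<delta>) * s + ((\<bar>A\<bar> + \<delta>) / \<delta> - real j) \<le> 0"
          using assms by (simp add: field_simps)
        then show ?thesis unfolding H_def by (simp add: \<sigma>)
      next
        case 2
        then have "(1 / \<delta>) * s + ((\<bar>A\<bar> + \<delta>) / \<delta> - real j) \<ge> 2"
          using assms by (simp add: field_simps)
        then show ?thesis unfolding H_def by (simp add: \<sigma>)
      qed
      with that show False by simp
    qed
    show "(\<Sum>j<n. H j s - H (Suc j) s) = 1" if "\<bar>s\<bar> \<le> A" for s
    proof -
      have "(1 / \<delta>) * s + ((\<bar>A\<bar> + \<delta>) / \<delta> - real 0) \<ge> 1"
        using that assms by (simp add: field_simps abs_if split: if_splits)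
      then have 1: "H 0 s = 1" unfolding H_def by (simp add: \<sigma>)
      have "2 * \<bar>A\<bar> + \<delta> \<le> \<delta> * real n"
        using n assms by (simp add: field_simps)
      then have "s + \<bar>A\<bar> + \<delta> \<le> \<delta> * real n"
        using that by linarith
      then have "(1 / \<delta>) * s + ((\<bar>A\<bar> + \<delta>) / \<delta> - real n) \<le> 0"
        using assms by (simp add: field_simps)
      then have 2: "H n s = 0" unfolding H_def by (simp add: \<sigma>)
      show ?thesis using 1 2 sum_lessThan_telescope'[of "\<lambda>j. H j s" n] by simp
    qed
  qed
qed

section \<open>Compactly supported test functions and cutoffs\<close>

definition test_fun :: "(real \<Rightarrow> complex) \<Rightarrow> bool"
  where "test_fun g \<longleftrightarrow> smooth g \<and> bounded {s. g s \<noteq> 0}"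

lemma test_fun_smooth: "test_fun g \<Longrightarrow> smooth g"
  by (simp add: test_fun_def)

lemma test_fun_supportE:
  assumes "test_fun g"
  obtains A where "A \<ge> 0" "\<And>s. \<bar>s\<bar> > A \<Longrightarrow> g s = 0"
proof -
  obtain B where B: "\<And>s. g s \<noteq> 0 \<Longrightarrow> \<bar>s\<bar> \<le> B"
    using assms by (auto simp: test_fun_def bounded_iff)
  show ?thesis
    using B by (intro that[of "\<bar>B\<bar>"]) force+
qed

lemma test_funI: "smooth g \<Longrightarrow> (\<And>s. \<bar>s\<bar> > A \<Longrightarrow> g s = 0) \<Longrightarrow> test_fun g"
  unfolding test_fun_def bounded_iff by (auto intro!: exI[of _ A] leI)

lemma test_fun_mult: "test_fun g \<Longrightarrow> smooth p \<Longrightarrow> test_fun (\<lambda>s. p s * g s)"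
  unfolding test_fun_def by (auto intro: smooth_mult bounded_subset)

lemma test_fun_add:
  assumes "test_fun f" "test_fun g"
  shows "test_fun (\<lambda>s. f s + g s)"
proof -
  have "bounded ({s. f s \<noteq> 0} \<union> {s. g s \<noteq> 0})"
    using assms by (simp add: test_fun_def)
  then have "bounded {s. f s + g s \<noteq> 0}"
    by (rule bounded_subset) auto
  with assms show ?thesis
    by (simp add: test_fun_def smooth_add)
qed

lemma test_fun_diff: "test_fun f \<Longrightarrow> test_fun g \<Longrightarrow> test_fun (\<lambda>s. f s - g s)"
  using test_fun_add[OF _ test_fun_mult[OF _ smooth_const[of "-1"]]] by simp

lemma deriv_eq_0_outside_closure:
  fixes g :: "real \<Rightarrow> complex"
  assumes "(g has_vector_derivative d) (at s)" "s \<notin> closure {s. g s \<noteq> 0}"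
  shows "d = 0"
proof -
  have "(g has_vector_derivative 0) (at s)"
    by (rule has_vector_derivative_transform_within_open[where f = "\<lambda>_. 0" and S = "- closure {s. g s \<noteq> 0}"])
       (use assms(2) closure_subset[of "{s. g s \<noteq> 0}"] in auto)
  with assms(1) show ?thesis
    by (rule vector_derivative_unique_at)
qed

text \<open>The clause on the support is there because later bounds on powers of a symbol hold only
  on the closed support of the function they multiply.\<close>

lemma test_fun_derivE:
  assumes "test_fun g"
  obtains g' where "\<And>t. (g has_vector_derivative g' t) (at t)" "test_fun g'"
    "\<And>t. g' t \<noteq> 0 \<Longrightarrow> t \<in> closure {s. g s \<noteq> 0}"
proof -
  obtain g' where g': "\<And>t. (g has_vector_derivative g' t) (at t)" "smooth g'"
    using assms smooth_derivE by (auto simp: test_fun_def)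
  have 0: "t \<in> closure {s. g s \<noteq> 0}" if "g' t \<noteq> 0" for t
    using deriv_eq_0_outside_closure[OF g'(1)[of t]] that by blast
  have "bounded (closure {s. g s \<noteq> 0})"
    using assms by (auto simp: test_fun_def intro: bounded_closure)
  then have "bounded {t. g' t \<noteq> 0}"
    by (rule bounded_subset) (use 0 in blast)
  with g' 0 that show ?thesis
    by (auto simp: test_fun_def)
qed

lemma test_fun_bounded:
  assumes "test_fun g"
  obtains B where "B \<ge> 0" "\<And>s. cmod (g s) \<le> B"
proof -
  obtain A where A: "A \<ge> 0" "\<And>s. \<bar>s\<bar> > A \<Longrightarrow> g s = 0"
    using test_fun_supportE[OF assms] by blast
  have "compact (g ` {-A..A})"
    by (intro compact_continuous_image smooth_continuous test_fun_smooth assms) auto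
  then obtain B where B: "\<And>s. s \<in> {-A..A} \<Longrightarrow> cmod (g s) \<le> B"
    by (fastforce dest!: compact_imp_bounded simp: bounded_iff)
  have "cmod (g s) \<le> \<bar>B\<bar>" for s
    using A(2)[of s] order_trans[OF B[of s] abs_ge_self]
    by (cases "\<bar>s\<bar> > A") (auto simp: abs_le_iff not_less)
  then show ?thesis using that[of "\<bar>B\<bar>"] by auto
qed

text \<open>The cutoff is the sum of those pieces of a fine partition of unity whose centres lie
  close to \<open>K\<close>.\<close>

lemma smooth_Urysohn:
  fixes K U :: "real set"
  assumes "compact K" "open U" "K \<subseteq> U"
  obtains \<kappa> N where "test_fun \<kappa>" "open N" "K \<subseteq> N" "\<And>s. s \<in> N \<Longrightarrow> \<kappa> s = 1"
    "closure {s. \<kappa> s \<noteq> 0} \<subseteq> U"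
proof -
  obtain e where e: "e > 0" "(\<Union>x\<in>K. ball x e) \<subseteq> U"
    using compact_subset_open_imp_ball_epsilon_subset[OF assms] by blast
  obtain B where B: "\<And>x. x \<in> K \<Longrightarrow> \<bar>x\<bar> \<le> B"
    using compact_imp_bounded[OF assms(1)] by (auto simp: bounded_iff)
  \<comment> \<open>A point of the support is within \<open>\<delta>\<close> of a centre, and that
    centre within \<open>2 \<delta>\<close> of \<open>K\<close>; the total \<open>3 \<delta>\<close>
    stays below \<open>e\<close>. Conversely, a piece that is nonzero at a point within
    \<open>\<delta>\<close> of \<open>K\<close> has its centre within \<open>2 \<delta>\<close> of
    \<open>K\<close>, so no piece is missing there and the sum is 1.\<close>
  define \<delta> where "\<delta> = e / 4"
  have "\<delta> > 0" using e by (simp add: \<delta>_def)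
  then obtain n :: nat and h :: "nat \<Rightarrow> real \<Rightarrow> complex" and c where h: "\<And>j. smooth (h j)"
      "\<And>j s. h j s \<noteq> 0 \<Longrightarrow> \<bar>s - c j\<bar> \<le> \<delta>"
      "\<And>s. \<bar>s\<bar> \<le> B + \<delta> \<Longrightarrow> (\<Sum>j<n. h j s) = 1"
    by (rule smooth_partition[where A = "B + \<delta>"]) blast
  define J where "J = {j. j < n \<and> (\<exists>x\<in>K. \<bar>x - c j\<bar> \<le> 2 * \<delta>)}"
  define \<kappa> where "\<kappa> s = (\<Sum>j\<in>J. h j s)" for s
  have supp: "s \<in> (\<Union>j\<in>J. cball (c j) \<delta>)" if "\<kappa> s \<noteq> 0" for s
  proof -
    have "\<exists>j\<in>J. h j s \<noteq> 0"
      using that sum.neutral[of J "\<lambda>j. h j s"] unfolding \<kappa>_def by blast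
    then obtain j where "j \<in> J" "h j s \<noteq> 0"
      by blast
    then show ?thesis using h(2)[of j s] by (auto simp: dist_real_def abs_minus_commute)
  qed
  have fin: "finite J" by (simp add: J_def)
  have cl: "closure {s. \<kappa> s \<noteq> 0} \<subseteq> (\<Union>j\<in>J. cball (c j) \<delta>)"
    using supp by (intro closure_minimal closed_UN[OF fin] subsetI ballI closed_cball) simp
  show ?thesis
  proof (rule that[of \<kappa> "\<Union>x\<in>K. ball x \<delta>"])
    show "test_fun \<kappa>"
      unfolding test_fun_def
    proof
      show "smooth \<kappa>" unfolding \<kappa>_def by (intro smooth_sum h)
      have "bounded (\<Union>j\<in>J. cball (c j) \<delta>)" using fin by auto
      then show "bounded {s. \<kappa> s \<noteq> 0}" by (rule bounded_subset) (use supp in blast)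
    qed
    show "open (\<Union>x\<in>K. ball x \<delta>)" by auto
    show "K \<subseteq> (\<Union>x\<in>K. ball x \<delta>)" using \<open>\<delta> > 0\<close> by auto
    show "\<kappa> s = 1" if s: "s \<in> (\<Union>x\<in>K. ball x \<delta>)" for s
    proof -
      obtain x where "x \<in> K" "s \<in> ball x \<delta>" using s by blast
      then have x: "x \<in> K" "\<bar>x - s\<bar> < \<delta>" by (simp_all only: mem_ball dist_real_def)
      have "\<bar>s\<bar> \<le> B + \<delta>" using x B[of x] by linarith
      then have "(\<Sum>j<n. h j s) = 1" by (rule h)
      also have "(\<Sum>j<n. h j s) = (\<Sum>j\<in>J. h j s)"
      proof (rule sum.mono_neutral_right)
        show "\<forall>i\<in>{..<n} - J. h i s = 0"
        proof
          fix i assume "i \<in> {..<n} - J"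
          then have "\<bar>x - c i\<bar> > 2 * \<delta>" using x by (auto simp: J_def)
          then show "h i s = 0" using h(2)[of i s] x by linarith
        qed
      qed (auto simp: J_def)
      finally show ?thesis by (simp add: \<kappa>_def)
    qed
    show "closure {s. \<kappa> s \<noteq> 0} \<subseteq> U"
    proof
      fix s assume "s \<in> closure {s. \<kappa> s \<noteq> 0}"
      then obtain j where j: "j \<in> J" "\<bar>c j - s\<bar> \<le> \<delta>" using cl by (auto simp: dist_real_def)
      then obtain x where x: "x \<in> K" "\<bar>x - c j\<bar> \<le> 2 * \<delta>" by (auto simp: J_def)
      have "\<bar>x - s\<bar> < e" using j x e(1) unfolding \<delta>_def by linarith
      then have "s \<in> ball x e" by (simp add: dist_real_def)
      then show "s \<in> U" using e(2) x by blast
    qed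
  qed
qed


section \<open>Fourier transforms\<close>

text \<open>A nonnegative Henstock-Kurzweil integrable function is Lebesgue integrable. This
  function is the majorant for all kernels below.\<close>

lemma integrable_inverse_square: "integrable lborel (\<lambda>t::real. inverse (1 + t\<^sup>2))"
proof -
  have "(\<lambda>t::real. inverse (1 + t\<^sup>2)) absolutely_integrable_on UNIV"
    using inverse_square_integrable[of 0] by (subst absolutely_integrable_on_iff_nonneg) auto
  then have "integrable lebesgue (\<lambda>t::real. inverse (1 + t\<^sup>2))"
    by (simp add: set_integrable_def)
  then show ?thesis
    by (subst (asm) integrable_completion) auto
qed

lemma measurable_fourier_kernel [measurable]:
  "(\<lambda>t. exp (- (\<i> * complex_of_real (s * t)))) \<in> borel_measurable borel"
  by (intro borel_measurable_continuous_onI continuous_intros)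

lemma norm_fourier_kernel [simp]: "cmod (exp (- (\<i> * complex_of_real (s * t)))) = 1"
  by (simp add: norm_exp_eq_Re)

lemma integrable_fourier_kernel:
  assumes "integrable lborel f"
  shows "integrable lborel (\<lambda>t. exp (- (\<i> * complex_of_real (s * t))) * f t)"
  by (rule Bochner_Integration.integrable_bound[OF assms])
     (use assms in \<open>auto simp: norm_mult simp del: of_real_mult\<close>)

lemma norm_fourier_le:
  assumes "integrable lborel f"
  shows "cmod (fourier f s) \<le> (LINT t|lborel. cmod (f t))"
proof -
  have "cmod (fourier f s) \<le> (LINT t|lborel. cmod (exp (- (\<i> * complex_of_real (s * t))) * f t))"
    unfolding fourier_def by (rule integral_norm_bound)
  then show ?thesis by (simp add: norm_mult del: of_real_mult)
qed

lemma fourier_mult_const: "fourier (\<lambda>t. c * f t) s = c * fourier f s"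
  unfolding fourier_def by (simp add: mult.left_commute)

lemma fourier_diff:
  "integrable lborel f \<Longrightarrow> integrable lborel g \<Longrightarrow> fourier (\<lambda>t. f t - g t) s = fourier f s - fourier g s"
  unfolding fourier_def
  by (simp add: right_diff_distrib Bochner_Integration.integral_diff integrable_fourier_kernel del: of_real_mult)

lemma fourier_sum:
  "(\<And>j. j \<in> I \<Longrightarrow> integrable lborel (f j)) \<Longrightarrow> fourier (\<lambda>t. \<Sum>j\<in>I. f j t) s = (\<Sum>j\<in>I. fourier (f j) s)"
  unfolding fourier_def
  by (simp add: sum_distrib_left Bochner_Integration.integral_sum integrable_fourier_kernel del: of_real_mult)

section \<open>Differentiating Fourier transforms\<close>

lemma has_vector_derivative_quadratic_bound:
  fixes F :: "real \<Rightarrow> 'b::real_normed_vector"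
  assumes "\<And>y. norm (F y - F s - (y - s) *\<^sub>R d) \<le> C * (y - s)\<^sup>2"
  shows "(F has_vector_derivative d) (at s)"
  unfolding has_vector_derivative_def
proof (rule has_derivativeI_sandwich[of 1])
  show "norm (F y - F s - (y - s) *\<^sub>R d) / norm (y - s) \<le> C * \<bar>y - s\<bar>" if "y \<noteq> s" for y
    using assms[of y] that by (simp add: divide_simps power2_eq_square mult.assoc flip: power2_abs)
  have "((\<lambda>y. C * \<bar>y - s\<bar>) \<longlongrightarrow> C * \<bar>s - s\<bar>) (at s)"
    by (intro tendsto_intros)
  then show "((\<lambda>y. C * \<bar>y - s\<bar>) \<longlongrightarrow> 0) (at s)" by simp
qed (auto intro: bounded_linear_scaleR_left)

lemma exp_second_order_bound: "cmod (exp (\<i> * of_real x) - 1 - \<i> * of_real x) \<le> x\<^sup>2"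
proof -
  have "2 * cmod (exp (\<i> * of_real x) - 1 - \<i> * of_real x) \<le> x\<^sup>2"
    using iexp_approx1[of x 1] by (simp add: numeral_2_eq_2 algebra_simps)
  then show ?thesis
    using norm_ge_zero[of "exp (\<i> * of_real x) - 1 - \<i> * of_real x"] by linarith
qed

text \<open>The first-order remainder of the kernel is at most \<open>((y - s) t)^2\<close>, so a
  finite second moment bounds the remainder of the transform by a multiple of
  \<open>(y - s)^2\<close>. This replaces a limit under the integral sign.\<close>

lemma fourier_has_vector_derivative:
  assumes int: "integrable lborel f" "integrable lborel (\<lambda>t. of_real t * f t)"
    "integrable lborel (\<lambda>t. of_real (t\<^sup>2) * f t)"
  shows "(fourier f has_vector_derivative fourier (\<lambda>t. - \<i> * (of_real t * f t)) s) (at s)"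
proof (rule has_vector_derivative_quadratic_bound)
  fix y
  let ?e = "\<lambda>s t. exp (- (\<i> * complex_of_real (s * t)))"
  let ?r = "\<lambda>t. ?e y t * f t - ?e s t * f t - (y - s) *\<^sub>R (?e s t * (- \<i> * (of_real t * f t)))"
  have i3: "integrable lborel (\<lambda>t. - \<i> * (of_real t * f t))"
    using int(2) by simp
  have "fourier f y - fourier f s - (y - s) *\<^sub>R fourier (\<lambda>t. - \<i> * (of_real t * f t)) s = (LINT t|lborel. ?r t)"
    unfolding fourier_def
    by (simp only: Bochner_Integration.integral_diff Bochner_Integration.integrable_diff
        integrable_fourier_kernel int i3 integrable_scaleR_right integral_scaleR_right)
  also have "norm \<dots> \<le> (LINT t|lborel. (y - s)\<^sup>2 * cmod (of_real (t\<^sup>2) * f t))"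
  proof (rule Bochner_Integration.integral_norm_bound_integral)
    show "integrable lborel ?r"
      by (intro Bochner_Integration.integrable_diff integrable_fourier_kernel int i3 integrable_scaleR_right)
    show "integrable lborel (\<lambda>t. (y - s)\<^sup>2 * cmod (of_real (t\<^sup>2) * f t))"
      by (intro integrable_mult_right integrable_norm int)
    show "norm (?r t) \<le> (y - s)\<^sup>2 * cmod (of_real (t\<^sup>2) * f t)" for t
    proof -
      define x where "x = - ((y - s) * t)"
      have "?e y t = ?e s t * exp (\<i> * of_real x)"
        unfolding x_def by (simp add: algebra_simps flip: exp_add)
      then have "?r t = ?e s t * ((exp (\<i> * of_real x) - 1 - \<i> * of_real x) * f t)"
        unfolding x_def by (simp add: algebra_simps scaleR_conv_of_real)
      then have "norm (?r t) = cmod (exp (\<i> * of_real x) - 1 - \<i> * of_real x) * cmod (f t)"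
        by (simp only: norm_mult norm_fourier_kernel mult_1)
      also have "\<dots> \<le> x\<^sup>2 * cmod (f t)"
        by (intro mult_right_mono exp_second_order_bound) auto
      finally show ?thesis
        by (simp add: x_def norm_mult norm_power power_mult_distrib)
    qed
  qed
  finally show "norm (fourier f y - fourier f s - (y - s) *\<^sub>R fourier (\<lambda>t. - \<i> * (of_real t * f t)) s)
      \<le> (LINT t|lborel. cmod (of_real (t\<^sup>2) * f t)) * (y - s)\<^sup>2"
    by (simp add: mult.commute)
qed

text \<open>Differentiating a transform multiplies the function by \<open>t\<close>. This class is
  stable under that operation, so differentiation can be iterated.\<close>

definition all_moments :: "(real \<Rightarrow> complex) \<Rightarrow> bool"
  where "all_moments f \<longleftrightarrow> (\<forall>k. integrable lborel (\<lambda>t. of_real (t ^ k) * f t))"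

lemma all_moments_integrable: "all_moments f \<Longrightarrow> integrable lborel f"
  by (auto simp: all_moments_def dest: spec[of _ 0])

lemma all_moments_mult: "all_moments f \<Longrightarrow> all_moments (\<lambda>t. c * (of_real t * f t))"
  unfolding all_moments_def
proof
  fix k assume "\<forall>k. integrable lborel (\<lambda>t. complex_of_real (t ^ k) * f t)"
  then have "integrable lborel (\<lambda>t. c * (complex_of_real (t ^ Suc k) * f t))"
    by (intro integrable_mult_right) blast
  then show "integrable lborel (\<lambda>t. complex_of_real (t ^ k) * (c * (of_real t * f t)))"
    by (simp add: algebra_simps)
qed

lemma fourier_deriv_all_moments:
  assumes "all_moments f"
  shows "(fourier f has_vector_derivative fourier (\<lambda>t. - \<i> * (of_real t * f t)) s) (at s)"
proof (rule fourier_has_vector_derivative)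
  show "integrable lborel f" by (rule all_moments_integrable[OF assms])
  have "integrable lborel (\<lambda>t. of_real (t ^ k) * f t)" for k
    using assms by (simp add: all_moments_def)
  from this[of 1] this[of 2] show "integrable lborel (\<lambda>t. of_real t * f t)"
    "integrable lborel (\<lambda>t. of_real (t\<^sup>2) * f t)"
    by (simp_all only: power_one_right)
qed

lemma smooth_fourier:
  assumes "all_moments f"
  shows "smooth (fourier f)"
proof -
  have "cdiff k (fourier f)" for k
    using assms
  proof (induction k arbitrary: f)
    case 0
    then show ?case
      using continuous_on_has_vector_derivative[OF fourier_deriv_all_moments] by simp
  next
    case (Suc k)
    show ?case
      by (rule cdiff_SucI[OF fourier_deriv_all_moments Suc.IH[OF all_moments_mult]])
         (rule Suc.prems)+
  qed
  then show ?thesis by (simp add: smooth_def)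
qed

lemma integrable_bounded_support:
  fixes f :: "real \<Rightarrow> complex"
  assumes "continuous_on UNIV f" "\<And>t. cmod (f t) \<le> B" "\<And>t. \<bar>t\<bar> > A \<Longrightarrow> f t = 0"
  shows "integrable lborel f"
proof (rule Bochner_Integration.integrable_bound)
  show "integrable lborel (\<lambda>t. indicator {-A..A} t *\<^sub>R B)"
    by (simp add: integrable_indicator_iff emeasure_lborel_Icc_eq)
  show "f \<in> borel_measurable lborel"
    using assms(1) borel_measurable_continuous_onI by simp
  show "AE t in lborel. norm (f t) \<le> norm (indicator {-A..A} t *\<^sub>R B)"
    using assms(2,3) order_trans[OF assms(2) abs_ge_self]
    by (intro AE_I2) (auto simp: indicator_def not_le abs_less_iff abs_le_iff)
qed

lemma test_fun_integrable:
  assumes "test_fun g"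
  shows "integrable lborel g"
proof -
  obtain B where B: "\<And>s. cmod (g s) \<le> B" by (rule test_fun_bounded[OF assms]) blast
  obtain A where A: "\<And>s. \<bar>s\<bar> > A \<Longrightarrow> g s = 0" by (rule test_fun_supportE[OF assms]) blast
  show ?thesis
    by (rule integrable_bounded_support[OF smooth_continuous[OF test_fun_smooth[OF assms]] B A])
qed

lemma test_fun_all_moments:
  assumes "test_fun g"
  shows "all_moments g"
  unfolding all_moments_def
proof
  fix k
  have "test_fun (\<lambda>t. of_real t ^ k * g t)"
    by (intro test_fun_mult assms smooth_power smooth_of_real)
  then show "integrable lborel (\<lambda>t. of_real (t ^ k) * g t)"
    using test_fun_integrable by simp
qed

lemma smooth_exp: "smooth (\<lambda>t. exp (c * of_real t))"
proof -
  have d: "((\<lambda>t. exp (c * of_real t)) has_vector_derivative c * exp (c * of_real t)) (at t)" for t :: real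
    by (rule has_vector_derivative_real_field) (auto intro!: derivative_eq_intros)
  have "cdiff k (\<lambda>t. exp (c * of_real t))" for k
  proof (induction k)
    case 0
    then show ?case by (auto intro!: continuous_intros)
  next
    case (Suc k)
    show ?case by (rule cdiff_SucI[OF d cdiff_mult[OF cdiff_const Suc]])
  qed
  then show ?thesis by (simp add: smooth_def)
qed

lemma integral_deriv_test_fun:
  assumes "test_fun F" and F': "\<And>t. (F has_vector_derivative F' t) (at t)"
  shows "(LINT t|lborel. F' t) = 0"
proof -
  \<comment> \<open>\<open>F'\<close> is given only as a derivative. Identifying it with the test
    function \<open>f\<close> provides its continuity and bounded support.\<close>
  obtain f where f: "\<And>t. (F has_vector_derivative f t) (at t)" "test_fun f"
    by (rule test_fun_derivE[OF assms(1)]) blast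
  have eq: "F' = f"
    using vector_derivative_unique_at[OF F' f(1)] by blast
  obtain A where A: "A \<ge> 0" "\<And>s. \<bar>s\<bar> > A \<Longrightarrow> F s = 0"
    by (rule test_fun_supportE[OF assms(1)]) blast
  obtain B where B: "B \<ge> 0" "\<And>s. \<bar>s\<bar> > B \<Longrightarrow> f s = 0"
    by (rule test_fun_supportE[OF f(2)]) blast
  \<comment> \<open>The summand 1 puts both endpoints strictly outside, since \<open>F\<close> and
    \<open>f\<close> are known to vanish only beyond \<open>A\<close> and \<open>B\<close>.\<close>
  define C where "C = max A B + 1"
  have "(LINT t|lborel. indicator {-C..C} t *\<^sub>R f t) = F C - F (-C)"
  proof (rule integral_FTC_Icc)
    show "- C \<le> C" using A(1) by (simp add: C_def)
    show "(F has_vector_derivative f x) (at x within {-C..C})" for x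
      by (rule has_vector_derivative_at_within[OF f(1)])
    show "continuous_on {-C..C} f" by (intro smooth_continuous test_fun_smooth f)
  qed
  also have "F C = 0" by (rule A(2)) (use A(1) in \<open>simp add: C_def\<close>)
  also have "F (- C) = 0" by (rule A(2)) (use A(1) in \<open>simp add: C_def\<close>)
  also have "(\<lambda>t. indicator {-C..C} t *\<^sub>R f t) = f"
    using B(2) by (auto simp: indicator_def C_def fun_eq_iff abs_le_iff)
  finally show ?thesis by (simp add: eq)
qed

text \<open>The kernel times \<open>g\<close> is itself a test function, so its derivative
  integrates to 0. The two terms of the product rule are the two sides.\<close>

lemma fourier_deriv:
  assumes g: "test_fun g" and g': "\<And>t. (g has_vector_derivative g' t) (at t)" "test_fun g'"
  shows "fourier g' s = \<i> * of_real s * fourier g s"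
proof -
  let ?e = "\<lambda>t. exp (- (\<i> * complex_of_real (s * t)))"
  have "((\<lambda>t. exp ((- \<i> * of_real s) * of_real t)) has_vector_derivative
      (- \<i> * of_real s) * exp ((- \<i> * of_real s) * of_real t)) (at t)" for t :: real
    by (rule has_vector_derivative_real_field) (auto intro!: derivative_eq_intros)
  then have d: "((\<lambda>t. ?e t * g t) has_vector_derivative ?e t * g' t + (- \<i> * of_real s) * ?e t * g t) (at t)" for t
    using has_vector_derivative_mult[OF _ g'(1)[of t], of ?e "(- \<i> * of_real s) * ?e t"]
    by (simp add: mult.assoc)
  have "smooth ?e"
    using smooth_exp[of "- \<i> * of_real s"] by (simp add: mult.assoc)
  then have "test_fun (\<lambda>t. ?e t * g t)"
    by (intro test_fun_mult g)
  from integral_deriv_test_fun[OF this d]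
  have "0 = (LINT t|lborel. ?e t * g' t + ?e t * ((- \<i> * of_real s) * g t))"
    by (simp add: mult_ac)
  also have "\<dots> = fourier g' s + fourier (\<lambda>t. (- \<i> * of_real s) * g t) s"
    unfolding fourier_def
    by (intro Bochner_Integration.integral_add integrable_fourier_kernel integrable_mult_right
        test_fun_integrable g g')
  finally show ?thesis by (simp only: fourier_mult_const) (simp add: algebra_simps)
qed


section \<open>Fourier inversion by Gaussian damping\<close>

lemma gaussian_fourier:
  assumes "\<epsilon> > 0"
  shows "(LINT s|lborel. exp (\<i> * of_real (r * s)) * of_real (std_normal_density (\<epsilon> * s)))
    = of_real (sqrt (2 * pi) / \<epsilon> * std_normal_density (r / \<epsilon>))"
proof -
  let ?f = "\<lambda>s. exp (\<i> * of_real (r * s)) * complex_of_real (std_normal_density (\<epsilon> * s))"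
  have "(LINT s|lborel. ?f s) = \<bar>1 / \<epsilon>\<bar> *\<^sub>R (LINT s|lborel. ?f (0 + 1 / \<epsilon> * s))"
    by (rule lborel_integral_real_affine) (use assms in auto)
  also have "(LINT s|lborel. ?f (0 + 1 / \<epsilon> * s))
      = (LINT s|lborel. std_normal_density s *\<^sub>R iexp (r / \<epsilon> * s))"
    using assms by (intro Bochner_Integration.integral_cong) (auto simp: scaleR_conv_of_real mult.commute)
  also have "\<dots> = char std_normal_distribution (r / \<epsilon>)"
    unfolding char_def by (subst integral_density) auto
  also have "\<dots> = of_real (exp (- ((r / \<epsilon>)\<^sup>2) / 2))"
    by (simp add: char_std_normal_distribution)
  also have "exp (- ((r / \<epsilon>)\<^sup>2) / 2) = sqrt (2 * pi) * std_normal_density (r / \<epsilon>)"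
    by (simp add: std_normal_density_def)
  finally show ?thesis
    using assms by (simp add: scaleR_conv_of_real)
qed

lemma integrable_std_normal_density: "integrable lborel (\<lambda>s. std_normal_density s)"
  by (rule integrable_normal_density) simp

lemma integrable_gaussian_dilation:
  "\<epsilon> > 0 \<Longrightarrow> integrable lborel (\<lambda>s. std_normal_density (\<epsilon> * s))"
  using lborel_integrable_real_affine[OF integrable_std_normal_density, of \<epsilon> 0] by simp

lemma continuous_std_normal_density: "continuous_on S std_normal_density"
  unfolding std_normal_density_def by (intro continuous_intros) auto

text \<open>The Gaussian factor makes the double integrand absolutely integrable, so the integrals
  may be exchanged. The inner one is the transform of a Gaussian, and
  \<open>t = x - \<epsilon> y\<close> rescales it to the standard density.\<close>

lemma fourier_gaussian_multiplication:
  assumes "integrable lborel f" and \<epsilon>: "\<epsilon> > 0"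
  shows "(LINT s|lborel. exp (\<i> * of_real (x * s)) * fourier f s * of_real (std_normal_density (\<epsilon> * s)))
    = of_real (sqrt (2 * pi)) * (LINT y|lborel. f (x - \<epsilon> * y) * of_real (std_normal_density y))"
proof -
  define h where "h s t = exp (\<i> * of_real ((x - t) * s)) * of_real (std_normal_density (\<epsilon> * s)) * f t" for s t
  have [measurable]: "f \<in> borel_measurable borel"
    using assms(1) by simp
  have cont[measurable]: "(\<lambda>p. exp (\<i> * complex_of_real ((x - snd p) * fst p))) \<in> borel_measurable borel"
    by (intro borel_measurable_continuous_onI continuous_intros)
  have norm_h: "norm (h s t) = std_normal_density (\<epsilon> * s) * norm (f t)" for s t
    unfolding h_def by (simp add: norm_mult norm_exp_eq_Re)
  have hm: "case_prod h \<in> borel_measurable (lborel \<Otimes>\<^sub>M lborel)"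
    unfolding h_def case_prod_beta by measurable
  have Fub: "integrable (lborel \<Otimes>\<^sub>M lborel) (case_prod h)"
  proof (rule lborel_pair.Fubini_integrable[OF hm])
    show "integrable lborel (\<lambda>s. LINT t|lborel. norm (case_prod h (s, t)))"
      using integrable_gaussian_dilation[OF \<epsilon>] by (simp add: norm_h)
    show "AE s in lborel. integrable lborel (\<lambda>t. case_prod h (s, t))"
    proof (intro AE_I2, rule Bochner_Integration.integrable_bound)
      fix s
      show "integrable lborel (\<lambda>t. std_normal_density (\<epsilon> * s) *\<^sub>R f t)"
        using assms(1) by simp
      show "(\<lambda>t. case_prod h (s, t)) \<in> borel_measurable lborel"
        using hm by simp
      show "AE t in lborel. norm (case_prod h (s, t)) \<le> norm (std_normal_density (\<epsilon> * s) *\<^sub>R f t)"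
        by (simp add: norm_h)
    qed
  qed
  have "(LINT s|lborel. exp (\<i> * of_real (x * s)) * fourier f s * of_real (std_normal_density (\<epsilon> * s)))
      = (LINT s|lborel. LINT t|lborel. h s t)"
  proof (rule Bochner_Integration.integral_cong[OF refl])
    fix s
    have "h s t = exp (\<i> * of_real (x * s)) * of_real (std_normal_density (\<epsilon> * s)) *
        (exp (- (\<i> * of_real (s * t))) * f t)" for t
      unfolding h_def by (simp add: algebra_simps flip: exp_add)
    then show "exp (\<i> * of_real (x * s)) * fourier f s * of_real (std_normal_density (\<epsilon> * s)) = (LINT t|lborel. h s t)"
      by (simp add: fourier_def)
  qed
  also have "\<dots> = (LINT t|lborel. LINT s|lborel. h s t)"
    using lborel_pair.Fubini_integral[OF Fub] by simp
  also have "\<dots> = (LINT t|lborel. of_real (sqrt (2 * pi) / \<epsilon> * std_normal_density ((x - t) / \<epsilon>)) * f t)"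
    unfolding h_def by (subst gaussian_fourier[OF \<epsilon>, symmetric]) simp
  also have "\<dots> = \<bar>- \<epsilon>\<bar> *\<^sub>R (LINT y|lborel.
      of_real (sqrt (2 * pi) / \<epsilon> * std_normal_density ((x - (x + - \<epsilon> * y)) / \<epsilon>)) * f (x + - \<epsilon> * y))"
    by (rule lborel_integral_real_affine) (use \<epsilon> in auto)
  also have "\<dots> = \<epsilon> *\<^sub>R (LINT y|lborel. of_real (sqrt (2 * pi) / \<epsilon>) * (f (x - \<epsilon> * y) * of_real (std_normal_density y)))"
    using \<epsilon> by (simp add: mult_ac)
  also have "\<dots> = of_real (sqrt (2 * pi)) * (LINT y|lborel. f (x - \<epsilon> * y) * of_real (std_normal_density y))"
    using \<epsilon> by (subst integral_mult_right_zero) (simp add: scaleR_conv_of_real)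
  finally show ?thesis .
qed

text \<open>Let the damping width tend to 0 on both sides of the previous identity. The left
  integrand is dominated by the transform, the right one by \<open>B\<close> times the density. The
  factor \<open>2 pi\<close> is the product of \<open>sqrt (2 pi)\<close> from the right and of
  \<open>1 / std_normal_density 0\<close> from the left.\<close>

theorem fourier_inversion:
  assumes cont: "continuous_on UNIV f" and bound: "\<And>t. cmod (f t) \<le> B"
    and int: "integrable lborel f" "integrable lborel (fourier f)"
  shows "fourier (fourier f) (- x) = of_real (2 * pi) * f x"
proof -
  define \<epsilon> where "\<epsilon> n = inverse (real (Suc n))" for n
  have \<epsilon>: "\<epsilon> n > 0" for n by (simp add: \<epsilon>_def)
  have \<epsilon>0: "\<epsilon> \<longlonglongrightarrow> 0" unfolding \<epsilon>_def by (rule LIMSEQ_inverse_real_of_nat)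
  have sc: "isCont std_normal_density y" for y
    using continuous_std_normal_density[of UNIV] by (simp add: continuous_on_eq_continuous_at)
  have fc: "isCont f y" for y
    using cont by (simp add: continuous_on_eq_continuous_at)
  have [measurable]: "f \<in> borel_measurable borel" "fourier f \<in> borel_measurable borel"
    using int by simp_all
  have [measurable]: "(\<lambda>s. exp (\<i> * complex_of_real (x * s))) \<in> borel_measurable borel"
    by (intro borel_measurable_continuous_onI continuous_intros)
  let ?L = "\<lambda>n s. exp (\<i> * of_real (x * s)) * fourier f s * of_real (std_normal_density (\<epsilon> n * s))"
  let ?R = "\<lambda>n y. f (x - \<epsilon> n * y) * of_real (std_normal_density y)"
  have le1: "std_normal_density y \<le> 1" for y
  proof -
    have "1 * 1 \<le> 2 * pi" using pi_gt3 by (intro mult_mono) auto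
    then have "1 / sqrt (2 * pi) \<le> 1 / 1"
      by (intro divide_left_mono) auto
    then have "1 / sqrt (2 * pi) * exp (- y\<^sup>2 / 2) \<le> 1 * 1"
      by (intro mult_mono) auto
    then show ?thesis by (simp add: std_normal_density_def)
  qed
  have "(\<lambda>n. LINT s|lborel. ?L n s) \<longlonglongrightarrow>
      (LINT s|lborel. exp (\<i> * of_real (x * s)) * fourier f s * of_real (std_normal_density 0))"
  proof (rule integral_dominated_convergence[where w = "\<lambda>s. cmod (fourier f s)"])
    show "AE s in lborel. (\<lambda>n. ?L n s) \<longlonglongrightarrow>
        exp (\<i> * of_real (x * s)) * fourier f s * of_real (std_normal_density 0)"
    proof (intro AE_I2 tendsto_intros)
      fix s
      have "(\<lambda>n. \<epsilon> n * s) \<longlonglongrightarrow> 0 * s" by (intro tendsto_intros \<epsilon>0)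
      then show "(\<lambda>n. std_normal_density (\<epsilon> n * s)) \<longlonglongrightarrow> std_normal_density 0"
        using isCont_tendsto_compose[OF sc] by simp
    qed
    show "AE s in lborel. norm (?L n s) \<le> cmod (fourier f s)" for n
      using le1 by (auto simp: norm_mult norm_exp_eq_Re mult_left_le)
    show "integrable lborel (\<lambda>s. cmod (fourier f s))" using int by simp
  qed measurable
  moreover have "(LINT s|lborel. exp (\<i> * of_real (x * s)) * fourier f s * of_real (std_normal_density 0))
      = fourier (fourier f) (- x) / of_real (sqrt (2 * pi))"
  proof -
    have "complex_of_real (std_normal_density 0) = 1 / of_real (sqrt (2 * pi))"
      by (simp add: std_normal_density_def)
    moreover have "fourier (fourier f) (- x) = (LINT s|lborel. exp (\<i> * of_real (x * s)) * fourier f s)"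
      unfolding fourier_def[of "fourier f"] by simp
    ultimately show ?thesis
      by (subst integral_mult_left_zero) (simp only: mult_1_right times_divide_eq_right)
  qed
  ultimately have L: "(\<lambda>n. LINT s|lborel. ?L n s) \<longlonglongrightarrow> fourier (fourier f) (- x) / of_real (sqrt (2 * pi))"
    by simp
  have "(\<lambda>n. LINT y|lborel. ?R n y) \<longlonglongrightarrow> (LINT y|lborel. f x * of_real (std_normal_density y))"
  proof (rule integral_dominated_convergence[where w = "\<lambda>y. B * std_normal_density y"])
    show "AE y in lborel. (\<lambda>n. ?R n y) \<longlonglongrightarrow> f x * of_real (std_normal_density y)"
    proof (intro AE_I2 tendsto_intros)
      fix y
      have "(\<lambda>n. x - \<epsilon> n * y) \<longlonglongrightarrow> x - 0 * y" by (intro tendsto_intros \<epsilon>0)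
      then show "(\<lambda>n. f (x - \<epsilon> n * y)) \<longlonglongrightarrow> f x"
        using isCont_tendsto_compose[OF fc] by simp
    qed
    show "AE y in lborel. norm (?R n y) \<le> B * std_normal_density y" for n
      using bound[of "x - \<epsilon> n * y" for y] by (intro AE_I2) (simp add: norm_mult mult_right_mono)
    show "integrable lborel (\<lambda>y. B * std_normal_density y)"
      by (intro integrable_mult_right integrable_std_normal_density)
  qed measurable
  moreover have "(LINT y|lborel. f x * of_real (std_normal_density y)) = f x"
    by (simp add: integral_normal_density)
  ultimately have "(\<lambda>n. of_real (sqrt (2 * pi)) * (LINT y|lborel. ?R n y)) \<longlonglongrightarrow> of_real (sqrt (2 * pi)) * f x"
    by (intro tendsto_intros) simp
  then have "(\<lambda>n. LINT s|lborel. ?L n s) \<longlonglongrightarrow> of_real (sqrt (2 * pi)) * f x"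
    by (simp only: fourier_gaussian_multiplication[OF int(1) \<epsilon>])
  from LIMSEQ_unique[OF L this]
  have "fourier (fourier f) (- x) = of_real (sqrt (2 * pi)) * of_real (sqrt (2 * pi)) * f x"
    by (simp add: field_simps)
  then show ?thesis
    by (simp flip: of_real_mult)
qed

section \<open>Schwartz functions and test functions as transforms of each other\<close>

lemma schwartz_decay:
  assumes "\<phi> \<in> schwartz"
  obtains B where "B \<ge> 0" "\<And>t. (1 + t\<^sup>2) * cmod (of_real (t ^ k) * \<phi> t) \<le> B"
proof -
  have "bounded (range (\<lambda>t. of_real (t ^ m) * iter_deriv 0 \<phi> t))" for m
    using assms unfolding schwartz_def by blast
  then have "\<exists>B. \<forall>t. cmod (of_real (t ^ m) * \<phi> t) \<le> B" for m
    by (auto simp: bounded_iff)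
  \<comment> \<open>Orders \<open>k\<close> and \<open>k + 2\<close> together give the weight
    \<open>1 + t^2\<close>, which makes the k-th moment integrable.\<close>
  from this[of k] this[of "k + 2"] obtain B C
    where B: "\<And>t. cmod (of_real (t ^ k) * \<phi> t) \<le> B" and C: "\<And>t. cmod (of_real (t ^ (k + 2)) * \<phi> t) \<le> C"
    by blast
  have "(1 + t\<^sup>2) * cmod (of_real (t ^ k) * \<phi> t) \<le> B + C" for t
  proof -
    have "t\<^sup>2 * cmod (of_real (t ^ k) * \<phi> t) = cmod (of_real (t ^ (k + 2)) * \<phi> t)"
      by (simp add: norm_mult norm_power power_add power2_eq_square)
    then show ?thesis
      using B[of t] C[of t] by (simp add: distrib_right)
  qed
  moreover from this[of 0] have "B + C \<ge> 0"
    by (rule order_trans[rotated]) simp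
  ultimately show ?thesis using that by blast
qed

lemma schwartz_continuous: "\<phi> \<in> schwartz \<Longrightarrow> continuous_on S \<phi>"
proof -
  assume "\<phi> \<in> schwartz"
  then have "\<forall>t. iter_deriv 0 \<phi> differentiable (at t)"
    unfolding schwartz_def by blast
  then show ?thesis
    by (intro continuous_at_imp_continuous_on ballI differentiable_imp_continuous_within) simp
qed

lemma schwartz_all_moments:
  assumes "\<phi> \<in> schwartz"
  shows "all_moments \<phi>"
  unfolding all_moments_def
proof
  fix k
  obtain B where B: "\<And>t. (1 + t\<^sup>2) * cmod (of_real (t ^ k) * \<phi> t) \<le> B"
    by (rule schwartz_decay[OF assms, of k]) blast
  have "continuous_on UNIV (\<lambda>t. of_real (t ^ k) * \<phi> t)"
    by (intro continuous_intros schwartz_continuous assms)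
  then have meas: "(\<lambda>t. of_real (t ^ k) * \<phi> t) \<in> borel_measurable borel"
    by (rule borel_measurable_continuous_onI)
  show "integrable lborel (\<lambda>t. of_real (t ^ k) * \<phi> t)"
  proof (rule Bochner_Integration.integrable_bound)
    show "integrable lborel (\<lambda>t. B * inverse (1 + t\<^sup>2))"
      by (intro integrable_mult_right integrable_inverse_square)
    show "AE t in lborel. norm (of_real (t ^ k) * \<phi> t) \<le> norm (B * inverse (1 + t\<^sup>2))"
    proof (rule AE_I2)
      fix t :: real
      have "1 + t\<^sup>2 > 0" by (rule add_pos_nonneg) auto
      then have "cmod (of_real (t ^ k) * \<phi> t) \<le> B * inverse (1 + t\<^sup>2)"
        using B[of t] by (simp add: field_simps)
      then show "norm (of_real (t ^ k) * \<phi> t) \<le> norm (B * inverse (1 + t\<^sup>2))" by simp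
    qed
  qed (use meas in simp)
qed

text \<open>Written as a reflected forward transform, so that bounds and derivative rules for
  \<open>fourier\<close> carry over.\<close>

definition inv_fourier :: "(real \<Rightarrow> complex) \<Rightarrow> real \<Rightarrow> complex"
  where "inv_fourier g t = fourier g (- t) / of_real (2 * pi)"

lemma inv_fourier_has_vector_derivative:
  assumes "test_fun g"
  shows "(inv_fourier g has_vector_derivative inv_fourier (\<lambda>s. \<i> * of_real s * g s) t) (at t)"
proof -
  have "((\<lambda>t. fourier g (- t)) has_vector_derivative - fourier (\<lambda>s. - \<i> * (of_real s * g s)) (- t)) (at t)"
    by (rule reflect_has_vector_derivative)
       (rule fourier_deriv_all_moments[OF test_fun_all_moments[OF assms]])
  also have "- fourier (\<lambda>s. - \<i> * (of_real s * g s)) (- t) = fourier (\<lambda>s. \<i> * of_real s * g s) (- t)"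
    by (simp only: fourier_mult_const mult.assoc) simp
  finally show ?thesis
    unfolding inv_fourier_def by (rule has_vector_derivative_divide)
qed

lemma test_fun_mult_power: "test_fun g \<Longrightarrow> test_fun (\<lambda>s. (\<i> * of_real s) ^ k * g s)"
  by (intro test_fun_mult smooth_power smooth_mult smooth_const smooth_of_real)

lemma iter_deriv_inv_fourier:
  assumes "test_fun g"
  shows "iter_deriv k (inv_fourier g) = inv_fourier (\<lambda>s. (\<i> * of_real s) ^ k * g s)"
proof (induction k)
  case (Suc k)
  have "vector_derivative (iter_deriv k (inv_fourier g)) (at t)
      = inv_fourier (\<lambda>s. \<i> * of_real s * ((\<i> * of_real s) ^ k * g s)) t" for t
    unfolding Suc by (intro vector_derivative_at inv_fourier_has_vector_derivative test_fun_mult_power assms)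
  then show ?case by (simp add: mult.assoc fun_eq_iff)
qed simp

text \<open>Each factor \<open>t\<close> is traded for a derivative of \<open>g\<close>:
  \<open>t\<close> times the inverse transform of \<open>g\<close> is \<open>\<i>\<close> times that
  of \<open>g'\<close>, and \<open>g'\<close> is again a test function.\<close>

lemma inv_fourier_moment_bounded:
  "test_fun g \<Longrightarrow> bounded (range (\<lambda>t. of_real (t ^ m) * inv_fourier g t))"
proof (induction m arbitrary: g)
  case 0
  have "cmod (inv_fourier g t) \<le> (LINT s|lborel. cmod (g s)) / (2 * pi)" for t
    using norm_fourier_le[OF test_fun_integrable[OF 0], of "- t"]
    by (simp add: inv_fourier_def norm_divide divide_right_mono)
  then show ?case by (auto simp: bounded_iff)
next
  case (Suc m)
  obtain g' where g': "\<And>t. (g has_vector_derivative g' t) (at t)" "test_fun g'"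
    by (rule test_fun_derivE[OF Suc.prems]) blast
  have eq: "of_real t * inv_fourier g t = \<i> * inv_fourier g' t" for t
    using fourier_deriv[OF Suc.prems g', of "- t"] by (simp add: inv_fourier_def flip: mult.assoc)
  have "bounded (range (\<lambda>t. of_real (t ^ m) * inv_fourier g' t))"
    by (rule Suc.IH[OF g'(2)])
  then obtain B where B: "\<And>t. cmod (of_real (t ^ m) * inv_fourier g' t) \<le> B"
    by (auto simp: bounded_iff)
  have "cmod (of_real (t ^ Suc m) * inv_fourier g t) \<le> B" for t
  proof -
    have "of_real (t ^ Suc m) * inv_fourier g t = of_real (t ^ m) * (of_real t * inv_fourier g t)"
      by simp
    also have "cmod \<dots> = cmod (of_real (t ^ m) * inv_fourier g' t)"
      unfolding eq by (simp add: norm_mult)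
    finally show ?thesis using B by simp
  qed
  then show ?case by (auto simp: bounded_iff)
qed

text \<open>Every derivative is again the inverse transform of a test function, so boundedness of
  its moments is the preceding lemma.\<close>

lemma inv_fourier_schwartz:
  assumes "test_fun g"
  shows "inv_fourier g \<in> schwartz"
  using inv_fourier_has_vector_derivative[OF test_fun_mult_power[OF assms]]
    inv_fourier_moment_bounded[OF test_fun_mult_power[OF assms]]
  unfolding schwartz_def mem_Collect_eq iter_deriv_inv_fourier[OF assms]
  by (blast intro: differentiableI_vector)

lemma fourier_inv_fourier:
  assumes "test_fun g"
  shows "fourier (inv_fourier g) = g"
proof
  fix s
  have int: "integrable lborel (inv_fourier g)"
    by (intro all_moments_integrable schwartz_all_moments inv_fourier_schwartz assms)
  \<comment> \<open>Inversion requires \<open>fourier g\<close> to be integrable. Up to a constant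
    it is the reflection of the Schwartz function \<open>inv_fourier g\<close>.\<close>
  have eq: "fourier g = (\<lambda>t. of_real (2 * pi) * inv_fourier g (0 + - 1 * t))"
    by (simp add: inv_fourier_def fun_eq_iff)
  have "integrable lborel (fourier g)"
    unfolding eq using lborel_integrable_real_affine[OF int, of "- 1" 0]
    by (intro integrable_mult_right) simp
  then have inv: "fourier (fourier g) (- s) = of_real (2 * pi) * g s"
    using test_fun_bounded[OF assms] fourier_inversion smooth_continuous test_fun_smooth
      test_fun_integrable assms by metis
  have "fourier (inv_fourier g) s
      = \<bar>- 1\<bar> *\<^sub>R (LINT t|lborel. exp (- (\<i> * of_real (s * (0 + - 1 * t)))) * inv_fourier g (0 + - 1 * t))"
    unfolding fourier_def by (rule lborel_integral_real_affine) simp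
  also have "\<dots> = fourier (fourier g) (- s) / of_real (2 * pi)"
    by (simp add: fourier_def[of "fourier g"] inv_fourier_def)
  finally show "fourier (inv_fourier g) s = g s"
    by (simp add: inv)
qed

text \<open>Translates the Schwartz functions in the definition of \<open>beurling_spectrum\<close>
  into test functions on the frequency side.\<close>

lemma schwartz_band_limited:
  assumes "\<phi> \<in> schwartz" "bounded {s. fourier \<phi> s \<noteq> 0}"
  shows "test_fun (fourier \<phi>)" "inv_fourier (fourier \<phi>) = \<phi>"
proof -
  show t: "test_fun (fourier \<phi>)"
    using assms by (simp add: test_fun_def smooth_fourier schwartz_all_moments)
  obtain B where B: "\<And>t. (1 + t\<^sup>2) * cmod (of_real (t ^ 0) * \<phi> t) \<le> B"
    by (rule schwartz_decay[OF assms(1), of 0]) blast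
  have "cmod (\<phi> t) \<le> B" for t
  proof -
    have "1 * cmod (\<phi> t) \<le> (1 + t\<^sup>2) * cmod (\<phi> t)"
      by (intro mult_right_mono) auto
    then show ?thesis using B[of t] by simp
  qed
  from fourier_inversion[OF schwartz_continuous[OF assms(1)] this
      all_moments_integrable[OF schwartz_all_moments[OF assms(1)]] test_fun_integrable[OF t]]
  show "inv_fourier (fourier \<phi>) = \<phi>"
    by (simp add: inv_fourier_def fun_eq_iff)
qed


section \<open>Convolutions and the resolvent\<close>

lemma convolution_sum:
  assumes "finite I" "\<And>j. j \<in> I \<Longrightarrow> \<phi> j \<in> schwartz"
  shows "convolution (\<lambda>t. \<Sum>j\<in>I. \<phi> j t) u s = (\<Sum>j\<in>I. convolution (\<phi> j) u s)"
  unfolding convolution_def scaleC.sum_left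
  by (rule Henstock_Kurzweil_Integration.integral_sum) (use assms convolution_integrable(1) in auto)

lemma inv_fourier_sum:
  "(\<And>j. j \<in> I \<Longrightarrow> test_fun (g j)) \<Longrightarrow> inv_fourier (\<lambda>s. \<Sum>j\<in>I. g j s) t = (\<Sum>j\<in>I. inv_fourier (g j) t)"
  by (simp add: inv_fourier_def fourier_sum test_fun_integrable sum_divide_distrib)

lemma inv_fourier_diff:
  "test_fun f \<Longrightarrow> test_fun g \<Longrightarrow> inv_fourier (\<lambda>s. f s - g s) t = inv_fourier f t - inv_fourier g t"
  by (simp add: inv_fourier_def fourier_diff test_fun_integrable diff_divide_distrib)

lemma convolution_inv_fourier_diff:
  fixes u :: "real \<Rightarrow>\<^sub>C 'a::complex_banach"
  assumes "test_fun f" "test_fun g"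
  shows "convolution (inv_fourier (\<lambda>s. f s - g s)) u t
    = convolution (inv_fourier f) u t - convolution (inv_fourier g) u t"
  unfolding convolution_def inv_fourier_diff[OF assms] scaleC.diff_left
  by (intro Henstock_Kurzweil_Integration.integral_diff convolution_integrable inv_fourier_schwartz assms)

section \<open>Integration by parts and the resolvent\<close>

lemma has_integral_UNIV_deriv:
  fixes F :: "real \<Rightarrow> 'a::banach"
  assumes F': "\<And>t. (F has_vector_derivative F' t) (at t)" and int: "F' integrable_on UNIV"
    and lim: "(F \<longlongrightarrow> 0) at_top" "(F \<longlongrightarrow> 0) at_bot"
  shows "integral UNIV F' = 0"
proof (rule ccontr)
  let ?i = "integral UNIV F'"
  assume "?i \<noteq> 0"
  \<comment> \<open>Three errors are each kept below a third of the norm: the two boundary values of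
    \<open>F\<close> and the truncation error of the integral.\<close>
  define e where "e = norm ?i / 3"
  have e: "e > 0" using \<open>?i \<noteq> 0\<close> by (simp add: e_def)
  have "\<nexists>a b. (UNIV :: real set) = cbox a b"
    by (metis bounded_cbox not_bounded_UNIV)
  then obtain B where B: "B > 0" "\<And>a b. ball 0 B \<subseteq> cbox a b \<Longrightarrow>
      \<exists>z. (F' has_integral z) (cbox a b) \<and> norm (z - ?i) < e"
    using integrable_integral[OF int] e by (subst (asm) has_integral_alt) auto
  obtain M where M: "\<And>t. t \<ge> M \<Longrightarrow> norm (F t) < e"
    using tendstoD[OF lim(1) e] by (auto simp: eventually_at_top_linorder)
  obtain L where L: "\<And>t. t \<le> L \<Longrightarrow> norm (F t) < e"
    using tendstoD[OF lim(2) e] by (auto simp: eventually_at_bot_linorder)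
  define a b where "a = min L (- B)" and "b = max M B"
  have "ball 0 B \<subseteq> cbox a b"
    by (auto simp: a_def b_def)
  then obtain z where z: "(F' has_integral z) (cbox a b)" "norm (z - ?i) < e"
    using B(2) by blast
  have "a \<le> b" using B(1) by (simp add: a_def b_def)
  then have "(F' has_integral F b - F a) (cbox a b)"
    unfolding cbox_interval
    by (rule fundamental_theorem_of_calculus) (rule has_vector_derivative_at_within[OF F'])
  with z(1) have "z = F b - F a"
    by (rule has_integral_unique)
  moreover have "norm (F b) < e" "norm (F a) < e"
    by (rule M, simp add: b_def, rule L, simp add: a_def)
  moreover have "norm ?i \<le> norm (F b) + norm (F a) + norm (F b - F a - ?i)"
    using norm_triangle_ineq4[of "F b - F a" "F b - F a - ?i"] norm_triangle_ineq4[of "F b" "F a"] by simp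
  ultimately have "norm ?i < 3 * e"
    using z(2) by simp
  then show False by (simp add: e_def)
qed

lemma schwartz_decay_0:
  assumes "\<phi> \<in> schwartz"
  obtains B where "B \<ge> 0" "\<And>t. cmod (\<phi> t) \<le> B * inverse (1 + t\<^sup>2)"
proof -
  obtain B where B: "B \<ge> 0" "\<And>t. (1 + t\<^sup>2) * cmod (of_real (t ^ 0) * \<phi> t) \<le> B"
    by (rule schwartz_decay[OF assms, of 0]) blast
  have "cmod (\<phi> t) \<le> B * inverse (1 + t\<^sup>2)" for t
  proof -
    have "1 + t\<^sup>2 > 0" by (rule add_pos_nonneg) auto
    then show ?thesis using B(2)[of t] by (simp add: field_simps)
  qed
  with B(1) that show ?thesis by blast
qed

lemma schwartz_tendsto_0:
  assumes "\<phi> \<in> schwartz"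
  shows "(\<phi> \<longlongrightarrow> 0) at_top" "(\<phi> \<longlongrightarrow> 0) at_bot"
proof -
  obtain B where B: "\<And>t. cmod (\<phi> t) \<le> B * inverse (1 + t\<^sup>2)"
    by (rule schwartz_decay_0[OF assms]) blast
  have "((\<lambda>t::real. B * inverse (1 + t\<^sup>2)) \<longlongrightarrow> 0) at_top" "((\<lambda>t::real. B * inverse (1 + t\<^sup>2)) \<longlongrightarrow> 0) at_bot"
    by real_asymp+
  then show "(\<phi> \<longlongrightarrow> 0) at_top" "(\<phi> \<longlongrightarrow> 0) at_bot"
    by (auto intro!: Lim_null_comparison[OF always_eventually[OF allI[OF B]]])
qed

lemma convolution_resolvent_equation:
  fixes v :: "real \<Rightarrow>\<^sub>C 'a::complex_banach"
  assumes g: "test_fun g" and v: "v \<in> diff_dom"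
  shows "convolution (inv_fourier g) (\<mu> *\<^sub>C v - diff_op v) s
    = convolution (inv_fourier (\<lambda>\<xi>. (\<mu> - \<i> * of_real \<xi>) * g \<xi>)) v s"
proof -
  define \<phi> where "\<phi> = inv_fourier g"
  define \<psi> where "\<psi> = inv_fourier (\<lambda>\<xi>. \<i> * of_real \<xi> * g \<xi>)"
  have t\<psi>: "test_fun (\<lambda>\<xi>. \<i> * of_real \<xi> * g \<xi>)"
    using test_fun_mult_power[OF g, of 1] by simp
  have \<phi>: "\<phi> \<in> schwartz" unfolding \<phi>_def by (rule inv_fourier_schwartz[OF g])
  have \<psi>: "\<psi> \<in> schwartz" unfolding \<psi>_def by (rule inv_fourier_schwartz[OF t\<psi>])
  have "inv_fourier (\<lambda>\<xi>. (\<mu> - \<i> * of_real \<xi>) * g \<xi>) t = \<mu> * \<phi> t - \<psi> t" for t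
    unfolding \<phi>_def \<psi>_def left_diff_distrib
    by (subst inv_fourier_diff[OF test_fun_mult[OF g smooth_const] t\<psi>])
       (simp add: inv_fourier_def fourier_mult_const)
  then have eq: "inv_fourier (\<lambda>\<xi>. (\<mu> - \<i> * of_real \<xi>) * g \<xi>) = (\<lambda>t. \<mu> * \<phi> t - \<psi> t)"
    by blast
  \<comment> \<open>Since \<open>\<phi>' = \<psi>\<close> and the argument is reflected, the product
    rule gives \<open>F'\<close>. The product vanishes at infinity because \<open>\<phi>\<close>
    decays and \<open>v\<close> is bounded, so the derivative can be moved from \<open>v\<close> to
    the kernel.\<close>
  define F where "F t = \<phi> (s - t) *\<^sub>C v t" for t
  define F' where "F' t = \<phi> (s - t) *\<^sub>C diff_op v t - \<psi> (s - t) *\<^sub>C v t" for t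
  have i1: "(\<lambda>t. \<phi> (s - t) *\<^sub>C diff_op v t) integrable_on UNIV"
    and i2: "(\<lambda>t. \<psi> (s - t) *\<^sub>C v t) integrable_on UNIV"
    and i3: "(\<lambda>t. \<phi> (s - t) *\<^sub>C v t) integrable_on UNIV"
    by (intro convolution_integrable \<phi> \<psi>)+
  have "integral UNIV F' = 0"
  proof (rule has_integral_UNIV_deriv)
    show "F' integrable_on UNIV"
      unfolding F'_def by (intro Henstock_Kurzweil_Integration.integrable_diff i1 i2)
    show "(F has_vector_derivative F' t) (at t)" for t
    proof -
      have "((\<lambda>t. s - t) has_vector_derivative - 1) (at t)"
        by (auto intro!: derivative_eq_intros)
      from vector_diff_chain_at[OF this inv_fourier_has_vector_derivative[OF g]]
      have "((\<lambda>t. \<phi> (s - t)) has_vector_derivative - \<psi> (s - t)) (at t)"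
        by (simp add: \<phi>_def \<psi>_def o_def)
      from scaleC.has_vector_derivative[OF this has_vector_derivative_diff_op[OF v, of t]]
      show ?thesis
        by (simp add: F_def[abs_def] F'_def scaleC.minus_left)
    qed
    have nF: "norm (F t) \<le> cmod (\<phi> (s - t)) * norm v" for t
      by (simp add: F_def norm_scaleC mult_left_mono norm_bounded)
    have top: "filterlim (\<lambda>t. s - t) at_bot at_top" and bot: "filterlim (\<lambda>t. s - t) at_top at_bot"
      by real_asymp+
    have "((\<lambda>t. cmod (\<phi> (s - t)) * norm v) \<longlongrightarrow> cmod 0 * norm v) at_top"
      by (intro tendsto_intros filterlim_compose[OF schwartz_tendsto_0(2)[OF \<phi>] top])
    then show "(F \<longlongrightarrow> 0) at_top"
      by (intro Lim_null_comparison[OF always_eventually[OF allI[OF nF]]]) simp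
    have "((\<lambda>t. cmod (\<phi> (s - t)) * norm v) \<longlongrightarrow> cmod 0 * norm v) at_bot"
      by (intro tendsto_intros filterlim_compose[OF schwartz_tendsto_0(1)[OF \<phi>] bot])
    then show "(F \<longlongrightarrow> 0) at_bot"
      by (intro Lim_null_comparison[OF always_eventually[OF allI[OF nF]]]) simp
  qed
  then have parts: "integral UNIV (\<lambda>t. \<phi> (s - t) *\<^sub>C diff_op v t) = integral UNIV (\<lambda>t. \<psi> (s - t) *\<^sub>C v t)"
    unfolding F'_def by (simp add: Henstock_Kurzweil_Integration.integral_diff i1 i2)
  have i4: "(\<lambda>t. (\<mu> * \<phi> (s - t)) *\<^sub>C v t) integrable_on UNIV"
    using integrable_linear[OF i3 scaleC.bounded_linear_right[of \<mu>]]
    by (simp add: o_def scaleC_scaleC)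
  have "convolution (inv_fourier g) (\<mu> *\<^sub>C v - diff_op v) s
      = integral UNIV (\<lambda>t. (\<mu> * \<phi> (s - t)) *\<^sub>C v t - \<phi> (s - t) *\<^sub>C diff_op v t)"
    by (simp add: convolution_def \<phi>_def scaleC.diff_right scaleC_scaleC mult.commute)
  also have "\<dots> = integral UNIV (\<lambda>t. (\<mu> * \<phi> (s - t)) *\<^sub>C v t) - integral UNIV (\<lambda>t. \<psi> (s - t) *\<^sub>C v t)"
    unfolding parts[symmetric] by (intro Henstock_Kurzweil_Integration.integral_diff i4 i1)
  also have "\<dots> = integral UNIV (\<lambda>t. (\<mu> * \<phi> (s - t)) *\<^sub>C v t - \<psi> (s - t) *\<^sub>C v t)"
    by (intro Henstock_Kurzweil_Integration.integral_diff[symmetric] i4 i2)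
  finally show ?thesis
    unfolding eq by (simp add: convolution_def scaleC.diff_left)
qed

lemma smooth_symbol: "smooth (\<lambda>\<xi>. \<mu> - \<i> * of_real \<xi>)"
  by (intro smooth_diff smooth_mult smooth_const smooth_of_real)

lemma symbol_nonzero: "Re \<mu> \<noteq> 0 \<Longrightarrow> \<mu> - \<i> * of_real \<xi> \<noteq> 0"
  by (auto simp: complex_eq_iff)

lemma convolution_resolvent_power:
  fixes u :: "real \<Rightarrow>\<^sub>C 'a::complex_banach"
  assumes "Re \<mu> \<noteq> 0" "test_fun g"
  shows "convolution (inv_fourier g) u s
    = convolution (inv_fourier (\<lambda>\<xi>. (\<mu> - \<i> * of_real \<xi>) ^ n * g \<xi>)) ((diff_resolvent \<mu> ^^ n) u) s"
proof (induction n)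
  case (Suc n)
  let ?w = "(diff_resolvent \<mu> ^^ n) u"
  have "test_fun (\<lambda>\<xi>. (\<mu> - \<i> * of_real \<xi>) ^ n * g \<xi>)"
    by (intro test_fun_mult assms smooth_power smooth_symbol)
  from convolution_resolvent_equation[OF this diff_resolvent_in_dom[OF assms(1), of ?w], of \<mu> s]
  show ?case
    by (simp add: Suc diff_resolvent_right_inverse[OF assms(1)] mult.assoc)
qed simp

text \<open>Apply the preceding lemma to the symbol divided by the n-th power; the powers cancel
  because the symbol has no real zero.\<close>

lemma convolution_resolvent_power_inverse:
  fixes u :: "real \<Rightarrow>\<^sub>C 'a::complex_banach"
  assumes "Re \<mu> \<noteq> 0" "test_fun g"
  shows "convolution (inv_fourier g) ((diff_resolvent \<mu> ^^ n) u) s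
    = convolution (inv_fourier (\<lambda>\<xi>. inverse (\<mu> - \<i> * of_real \<xi>) ^ n * g \<xi>)) u s"
proof -
  have "test_fun (\<lambda>\<xi>. inverse (\<mu> - \<i> * of_real \<xi>) ^ n * g \<xi>)"
    by (intro test_fun_mult assms smooth_power smooth_inverse smooth_symbol symbol_nonzero)
  from convolution_resolvent_power[OF assms(1) this, of u s n] show ?thesis
    using symbol_nonzero[OF assms(1)] by (simp add: field_simps)
qed

section \<open>Integrable majorants for kernels with a power in the symbol\<close>

definition poisson_mass :: real
  where "poisson_mass = (LINT t|lborel. inverse (1 + t\<^sup>2))"

lemma has_integral_inverse_square:
  "((\<lambda>t::real. inverse (1 + (t - s)\<^sup>2)) has_integral poisson_mass) UNIV"
proof -
  have "integrable lborel (\<lambda>t::real. inverse (1 + (t - s)\<^sup>2))"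
    using lborel_integrable_real_affine[OF integrable_inverse_square, of 1 "- s"] by simp
  from has_integral_integral_lborel[OF this]
  show ?thesis
    using lborel_integral_real_affine[of 1 "\<lambda>t::real. inverse (1 + t\<^sup>2)" "- s"]
    by (simp add: poisson_mass_def)
qed

text \<open>The L1 norm of \<open>\<phi>\<close> is replaced by the mass of its majorant. The mass
  \<open>poisson_mass\<close> is the number \<pi>, and translation does not change it.\<close>

lemma norm_convolution_le:
  fixes u :: "real \<Rightarrow>\<^sub>C 'a::complex_banach"
  assumes "\<phi> \<in> schwartz" and bound: "\<And>t. cmod (\<phi> t) \<le> K * inverse (1 + t\<^sup>2)"
  shows "norm (convolution \<phi> u s) \<le> K * poisson_mass * norm u"
proof -
  have I: "((\<lambda>t. K * inverse (1 + (t - s)\<^sup>2) * norm u) has_integral K * poisson_mass * norm u) UNIV"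
    by (intro has_integral_mult_left has_integral_mult_right has_integral_inverse_square)
  have "norm (convolution \<phi> u s) \<le> integral UNIV (\<lambda>t. K * inverse (1 + (t - s)\<^sup>2) * norm u)"
    unfolding convolution_def
  proof (rule integral_norm_bound_integral)
    show "norm (\<phi> (s - t) *\<^sub>C u t) \<le> K * inverse (1 + (t - s)\<^sup>2) * norm u" for t
      using bound[of "s - t"] unfolding norm_scaleC power2_commute[of t s]
      by (intro mult_mono norm_bounded) (auto intro: order_trans[OF norm_ge_zero])
  qed (use convolution_integrable(1)[OF assms(1)] I in auto)
  then show ?thesis unfolding integral_unique[OF I] .
qed

lemma norm_fourier_le_support:
  assumes g: "test_fun g" and B: "\<And>s. cmod (g s) \<le> B" and A: "A \<ge> 0" "\<And>s. \<bar>s\<bar> > A \<Longrightarrow> g s = 0"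
  shows "cmod (fourier g t) \<le> 2 * A * B"
proof -
  have "cmod (fourier g t) \<le> (LINT s|lborel. cmod (g s))"
    by (intro norm_fourier_le test_fun_integrable g)
  also have "\<dots> \<le> (LINT s|lborel. indicator {-A..A} s *\<^sub>R B)"
  proof (rule integral_mono)
    show "integrable lborel (\<lambda>s. cmod (g s))" using test_fun_integrable[OF g] by simp
    show "integrable lborel (\<lambda>s. indicator {-A..A} s *\<^sub>R B)"
      by (simp add: integrable_indicator_iff emeasure_lborel_Icc_eq)
    show "cmod (g s) \<le> indicator {-A..A} s *\<^sub>R B" for s
      using B[of s] A(2)[of s] by (auto simp: indicator_def)
  qed
  also have "\<dots> = 2 * A * B" using A(1) by simp
  finally show ?thesis .
qed

text \<open>Two integrations by parts turn \<open>t^2\<close> times the transform into the transform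
  of \<open>g''\<close>, up to sign. Each of the two transforms is at most \<open>2 A B\<close>,
  which adds up to \<open>4 A B\<close>; the factor \<open>1 / (2 pi)\<close> is bounded by
  1.\<close>

lemma inv_fourier_decay:
  assumes g: "test_fun g" "\<And>s. cmod (g s) \<le> B" "A \<ge> 0" "\<And>s. \<bar>s\<bar> > A \<Longrightarrow> g s = 0"
    and g': "\<And>t. (g has_vector_derivative g' t) (at t)" "test_fun g'"
    and g'': "\<And>t. (g' has_vector_derivative g'' t) (at t)" "test_fun g''"
      "\<And>s. cmod (g'' s) \<le> B" "\<And>s. \<bar>s\<bar> > A \<Longrightarrow> g'' s = 0"
  shows "cmod (inv_fourier g t) \<le> 4 * A * B * inverse (1 + t\<^sup>2)"
proof -
  have "fourier g'' (- t) = - (of_real (t\<^sup>2) * fourier g (- t))"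
    unfolding fourier_deriv[OF g'(2) g''(1,2)] fourier_deriv[OF g(1) g']
    by (simp add: complex_eq_iff power2_eq_square algebra_simps)
  then have "t\<^sup>2 * cmod (fourier g (- t)) = cmod (fourier g'' (- t))"
    by (simp add: norm_mult norm_power)
  also have "\<dots> \<le> 2 * A * B"
    by (rule norm_fourier_le_support[OF g''(2,3) g(3) g''(4)])
  finally have "(1 + t\<^sup>2) * cmod (fourier g (- t)) \<le> 4 * A * B"
    using norm_fourier_le_support[OF g, of "- t"] by (simp add: distrib_right)
  moreover have "cmod (inv_fourier g t) \<le> cmod (fourier g (- t))"
  proof -
    have "cmod (inv_fourier g t) = cmod (fourier g (- t)) / (2 * pi)"
      by (simp add: inv_fourier_def norm_divide)
    also have "\<dots> \<le> cmod (fourier g (- t)) / 1"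
      by (rule divide_left_mono) (use pi_gt3 in auto)
    finally show ?thesis by simp
  qed
  then have "(1 + t\<^sup>2) * cmod (inv_fourier g t) \<le> (1 + t\<^sup>2) * cmod (fourier g (- t))"
    by (intro mult_left_mono) auto
  ultimately have "(1 + t\<^sup>2) * cmod (inv_fourier g t) \<le> 4 * A * B"
    by linarith
  moreover have "1 + t\<^sup>2 > 0" by (rule add_pos_nonneg) auto
  ultimately show ?thesis by (simp add: field_simps)
qed

text \<open>Writing \<open>p' = p q\<close> keeps the factor \<open>p ^ n\<close> intact under differentiation, so that two
  derivatives of \<open>p ^ n h\<close> cost only a factor \<open>n\<^sup>2\<close>.\<close>

lemma has_vector_derivative_power_mult:
  fixes p h :: "real \<Rightarrow> complex"
  assumes "(p has_vector_derivative p s * q s) (at s)" "(h has_vector_derivative h' s) (at s)"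
  shows "((\<lambda>s. p s ^ n * h s) has_vector_derivative p s ^ n * (of_nat n * (q s * h s) + h' s)) (at s)"
proof -
  have "((\<lambda>s. p s ^ n) has_vector_derivative of_nat n * q s * p s ^ n) (at s)"
  proof (induction n)
    case (Suc n)
    from has_vector_derivative_mult[OF assms(1) Suc] show ?case
      by (simp add: algebra_simps)
  qed simp
  from has_vector_derivative_mult[OF this assms(2)] show ?thesis
    by (simp add: algebra_simps)
qed

text \<open>The point is that \<open>K\<close> is chosen before \<open>n\<close>. All dependence on
  \<open>n\<close> sits in the factor \<open>p ^ n\<close> and in polynomial coefficients, and
  \<open>p\<close> is bounded only where \<open>h\<close> lives.\<close>

lemma inv_fourier_power_mult_decay:
  assumes p: "smooth p" "\<And>s. (p has_vector_derivative p s * q s) (at s)" and q: "smooth q"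
    and h: "test_fun h" and M: "\<And>s. s \<in> closure {s. h s \<noteq> 0} \<Longrightarrow> cmod (p s) \<le> M" and M0: "M \<ge> 0"
  obtains K where "\<And>n t. cmod (inv_fourier (\<lambda>s. p s ^ n * h s) t) \<le> K * real (n + 1) ^ 2 * M ^ n * inverse (1 + t\<^sup>2)"
proof -
  obtain h' where h': "\<And>t. (h has_vector_derivative h' t) (at t)" "test_fun h'"
      "\<And>t. h' t \<noteq> 0 \<Longrightarrow> t \<in> closure {s. h s \<noteq> 0}"
    by (rule test_fun_derivE[OF h]) blast
  obtain h'' where h'': "\<And>t. (h' has_vector_derivative h'' t) (at t)" "test_fun h''"
      "\<And>t. h'' t \<noteq> 0 \<Longrightarrow> t \<in> closure {s. h' s \<noteq> 0}"
    by (rule test_fun_derivE[OF h'(2)]) blast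
  obtain q' where q': "\<And>t. (q has_vector_derivative q' t) (at t)" "smooth q'"
    by (rule smooth_derivE[OF q]) blast
  let ?S = "closure {s. h s \<noteq> 0}"
  have supp: "h s = 0" "h' s = 0" "h'' s = 0" if "s \<notin> ?S" for s
  proof -
    show "h s = 0" using that closure_subset[of "{s. h s \<noteq> 0}"] by auto
    show "h' s = 0" using that h'(3) by blast
    have "closure {s. h' s \<noteq> 0} \<subseteq> ?S"
      using h'(3) by (intro closure_minimal) auto
    then show "h'' s = 0" using that h''(3) by blast
  qed
  have "bounded ?S" using h by (auto simp: test_fun_def intro: bounded_closure)
  then obtain A0 where "\<And>s. s \<in> ?S \<Longrightarrow> \<bar>s\<bar> \<le> A0"
    by (auto simp: bounded_iff)
  then have A: "s \<notin> ?S" if "\<bar>s\<bar> > \<bar>A0\<bar>" for s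
    using that by force
  \<comment> \<open>The second derivative of \<open>p ^ n h\<close> is \<open>p ^ n\<close> times
    \<open>n^2 a + n b + h''\<close>. The coefficients do not involve \<open>n\<close>, so their
    bounds are uniform.\<close>
  define a where "a s = q s * (q s * h s)" for s
  define b where "b s = q s * h' s + (q s * h' s + q' s * h s)" for s
  have tests: "test_fun a" "test_fun b"
    unfolding a_def b_def by (intro test_fun_add test_fun_mult h h' q q')+
  obtain Ba where Ba: "Ba \<ge> 0" "\<And>s. cmod (a s) \<le> Ba" by (rule test_fun_bounded[OF tests(1)]) blast
  obtain Bb where Bb: "Bb \<ge> 0" "\<And>s. cmod (b s) \<le> Bb" by (rule test_fun_bounded[OF tests(2)]) blast
  obtain Bc where Bc: "Bc \<ge> 0" "\<And>s. cmod (h'' s) \<le> Bc" by (rule test_fun_bounded[OF h''(2)]) blast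
  obtain Bh where Bh: "Bh \<ge> 0" "\<And>s. cmod (h s) \<le> Bh" by (rule test_fun_bounded[OF h]) blast
  define C where "C = Ba + Bb + Bc + Bh"
  show ?thesis
  proof (rule that[of "4 * \<bar>A0\<bar> * C"])
    fix n t
    define h1 where "h1 s = of_nat n * (q s * h s) + h' s" for s
    define h1' where "h1' s = of_nat n * (q s * h' s + q' s * h s) + h'' s" for s
    define h2 where "h2 s = of_nat n * (q s * h1 s) + h1' s" for s
    have t1: "test_fun h1" "test_fun h1'"
      unfolding h1_def h1'_def by (intro test_fun_add test_fun_mult h h' h'' q q' smooth_const)+
    have t2: "test_fun h2"
      unfolding h2_def by (intro test_fun_add test_fun_mult t1 q smooth_const)
    have d1: "(h1 has_vector_derivative h1' s) (at s)" for s
      unfolding h1_def h1'_def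
      by (intro has_vector_derivative_add has_vector_derivative_mult_right has_vector_derivative_mult h' h'' q')
    have h2_eq: "h2 s = of_nat (n\<^sup>2) * a s + of_nat n * b s + h'' s" for s
      by (simp add: h2_def h1_def h1'_def a_def b_def algebra_simps power2_eq_square)
    \<comment> \<open>Using \<open>n + 1\<close> instead of \<open>n\<close> dominates 1,
      \<open>n\<close> and \<open>n^2\<close> at once, including the case where \<open>n\<close> is
      0.\<close>
    define N where "N = (real (n + 1))\<^sup>2"
    have N: "1 \<le> N" "real n \<le> N" "(real n)\<^sup>2 \<le> N"
      by (auto simp: N_def power2_eq_square algebra_simps)
    have b2: "cmod (h2 s) \<le> N * C" for s
    proof -
      have "cmod (h2 s) \<le> cmod (of_nat (n\<^sup>2) * a s) + cmod (of_nat n * b s) + cmod (h'' s)"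
        unfolding h2_eq by (intro norm_triangle_le add_right_mono norm_triangle_ineq)
      also have "\<dots> = (real n)\<^sup>2 * cmod (a s) + real n * cmod (b s) + 1 * cmod (h'' s)"
        by (simp add: norm_mult norm_power)
      also have "\<dots> \<le> N * Ba + N * Bb + N * Bc"
        using Ba Bb Bc N by (intro add_mono mult_mono) auto
      also have "\<dots> \<le> N * C"
        using Bh N by (simp add: C_def distrib_left)
      finally show ?thesis .
    qed
    have b0: "cmod (h s) \<le> N * C" for s
    proof -
      have "cmod (h s) \<le> 1 * C" using Bh(2)[of s] Ba(1) Bb(1) Bc(1) by (simp add: C_def)
      also have "\<dots> \<le> N * C" using N Ba Bb Bc Bh by (intro mult_right_mono) (auto simp: C_def)
      finally show ?thesis .
    qed
    \<comment> \<open>Off the support nothing is known about the size of \<open>p\<close>, but there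
      the other factor vanishes.\<close>
    have power: "cmod (p s ^ n * f s) \<le> N * C * M ^ n"
      if f: "cmod (f s) \<le> N * C" "s \<notin> ?S \<Longrightarrow> f s = 0" for f :: "real \<Rightarrow> complex" and s
    proof (cases "s \<in> ?S")
      case True
      have "cmod (p s ^ n * f s) = cmod (f s) * cmod (p s) ^ n"
        by (simp add: norm_mult norm_power)
      also have "\<dots> \<le> N * C * M ^ n"
        using M[OF True] f N Ba Bb Bc Bh by (intro mult_mono power_mono) (auto simp: C_def)
      finally show ?thesis .
    next
      case False
      then show ?thesis using f(2) N Ba Bb Bc Bh M0 by (simp add: C_def)
    qed
    have supp2: "h2 s = 0" if "s \<notin> ?S" for s
      using supp[OF that] by (simp add: h2_def h1_def h1'_def)
    have "cmod (inv_fourier (\<lambda>s. p s ^ n * h s) t) \<le> 4 * \<bar>A0\<bar> * (N * C * M ^ n) * inverse (1 + t\<^sup>2)"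
    proof (rule inv_fourier_decay)
      show "((\<lambda>s. p s ^ n * h s) has_vector_derivative p s ^ n * h1 s) (at s)" for s
        unfolding h1_def by (intro has_vector_derivative_power_mult p h')
      show "((\<lambda>s. p s ^ n * h1 s) has_vector_derivative p s ^ n * h2 s) (at s)" for s
        unfolding h2_def by (intro has_vector_derivative_power_mult p d1)
      show "cmod (p s ^ n * h s) \<le> N * C * M ^ n" for s
        by (rule power[OF b0 supp(1)])
      show "cmod (p s ^ n * h2 s) \<le> N * C * M ^ n" for s
        by (rule power[OF b2 supp2])
      show "test_fun (\<lambda>s. p s ^ n * h s)" "test_fun (\<lambda>s. p s ^ n * h1 s)" "test_fun (\<lambda>s. p s ^ n * h2 s)"
        by (intro test_fun_mult smooth_power p h t1 t2)+
      show "p s ^ n * h s = 0" "p s ^ n * h2 s = 0" if "\<bar>A0\<bar> < \<bar>s\<bar>" for s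
        by (simp_all add: supp(1)[OF A[OF that]] supp2[OF A[OF that]])
    qed simp
    then show "cmod (inv_fourier (\<lambda>s. p s ^ n * h s) t) \<le> 4 * \<bar>A0\<bar> * C * real (n + 1) ^ 2 * M ^ n * inverse (1 + t\<^sup>2)"
      by (simp add: N_def mult_ac)
  qed
qed


section \<open>Convolutions and the Beurling spectrum\<close>

text \<open>The definition of the spectrum speaks only of symbols supported in small intervals.
  Compactness of the support of \<open>g\<close> allows a cut into finitely many such
  symbols.\<close>

lemma convolution_eq_0_off_spectrum:
  fixes u :: "real \<Rightarrow>\<^sub>C 'a::complex_banach"
  assumes g: "test_fun g" and disj: "closure {s. g s \<noteq> 0} \<inter> beurling_spectrum u = {}"
  shows "convolution (inv_fourier g) u t = 0"
proof -
  define L where "L = closure {s. g s \<noteq> 0}"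
  have "compact L"
    using g by (simp add: L_def test_fun_def)
  have "\<exists>\<epsilon>>0. \<forall>\<phi>\<in>schwartz. closure {s. fourier \<phi> s \<noteq> 0} \<subseteq> {\<xi> - \<epsilon><..<\<xi> + \<epsilon>} \<longrightarrow> convolution \<phi> u t = 0"
    if "\<xi> \<in> L" for \<xi>
    using disj that unfolding L_def beurling_spectrum_def by blast
  then obtain \<epsilon> where \<epsilon>: "\<And>\<xi>. \<xi> \<in> L \<Longrightarrow> \<epsilon> \<xi> > 0"
      "\<And>\<xi> \<phi>. \<xi> \<in> L \<Longrightarrow> \<phi> \<in> schwartz \<Longrightarrow> closure {s. fourier \<phi> s \<noteq> 0} \<subseteq> {\<xi> - \<epsilon> \<xi><..<\<xi> + \<epsilon> \<xi>} \<Longrightarrow>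
        convolution \<phi> u t = 0"
    by metis
  define \<G> where "\<G> = (\<lambda>\<xi>. {\<xi> - \<epsilon> \<xi><..<\<xi> + \<epsilon> \<xi>}) ` L"
  have "L \<subseteq> \<Union>\<G>"
  proof
    fix \<xi> assume "\<xi> \<in> L"
    then have "\<xi> \<in> {\<xi> - \<epsilon> \<xi><..<\<xi> + \<epsilon> \<xi>}" using \<epsilon>(1) by simp
    then show "\<xi> \<in> \<Union>\<G>" using \<open>\<xi> \<in> L\<close> unfolding \<G>_def by blast
  qed
  \<comment> \<open>\<open>e\<close> is a Lebesgue number of the cover.\<close>
  then obtain e where e: "0 < e" "\<And>x. x \<in> L \<Longrightarrow> \<exists>G\<in>\<G>. ball x e \<subseteq> G"
    by (rule Heine_Borel_lemma[OF \<open>compact L\<close>]) (auto simp: \<G>_def)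
  obtain A where A: "\<And>s. \<bar>s\<bar> > A \<Longrightarrow> g s = 0"
    by (rule test_fun_supportE[OF g]) blast
  \<comment> \<open>Two points of one piece are both within \<open>e / 3\<close> of its centre,
    hence less than \<open>e\<close> apart. So a piece that meets the support fits into one interval
    of the cover.\<close>
  have "e / 3 > 0" using e by simp
  then obtain n :: nat and h :: "nat \<Rightarrow> real \<Rightarrow> complex" and c where h: "\<And>j. smooth (h j)"
      "\<And>j s. h j s \<noteq> 0 \<Longrightarrow> \<bar>s - c j\<bar> \<le> e / 3"
      "\<And>s. \<bar>s\<bar> \<le> A \<Longrightarrow> (\<Sum>j<n. h j s) = 1"
    by (rule smooth_partition[where A = A]) blast
  have tg: "test_fun (\<lambda>s. h j s * g s)" for j
    by (intro test_fun_mult g h)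
  have eq: "g = (\<lambda>s. \<Sum>j<n. h j s * g s)"
    using A h(3) by (fastforce simp: not_less simp flip: sum_distrib_right)
  have zero: "convolution (inv_fourier (\<lambda>s. h j s * g s)) u t = 0" for j
  proof (cases "\<exists>x. h j x * g x \<noteq> 0")
    case True
    then obtain x where x: "h j x \<noteq> 0" "g x \<noteq> 0" by auto
    have "x \<in> L" using x closure_subset[of "{s. g s \<noteq> 0}"] by (auto simp: L_def)
    then obtain \<xi> where \<xi>: "\<xi> \<in> L" "ball x e \<subseteq> {\<xi> - \<epsilon> \<xi><..<\<xi> + \<epsilon> \<xi>}"
      using e(2) by (auto simp: \<G>_def)
    have "closure {s. h j s * g s \<noteq> 0} \<subseteq> cball (c j) (e / 3)"
      by (rule closure_minimal) (use h(2)[of j] in \<open>auto simp: dist_real_def abs_minus_commute\<close>)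
    also have "\<dots> \<subseteq> ball x e"
    proof
      fix s assume "s \<in> cball (c j) (e / 3)"
      then have "\<bar>c j - s\<bar> \<le> e / 3" by (simp only: mem_cball dist_real_def)
      then have "\<bar>x - s\<bar> < e" using h(2)[OF x(1)] e(1) by linarith
      then show "s \<in> ball x e" by (simp only: mem_ball dist_real_def)
    qed
    finally have "closure {s. fourier (inv_fourier (\<lambda>s. h j s * g s)) s \<noteq> 0} \<subseteq> {\<xi> - \<epsilon> \<xi><..<\<xi> + \<epsilon> \<xi>}"
      using \<xi>(2) unfolding fourier_inv_fourier[OF tg] by blast
    then show ?thesis
      by (rule \<epsilon>(2)[OF \<xi>(1) inv_fourier_schwartz[OF tg]])
  next
    case False
    then have "(\<lambda>s. h j s * g s) = (\<lambda>_. 0)" by blast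
    then show ?thesis
      by (simp add: inv_fourier_def[abs_def] fourier_def convolution_def scaleC.zero_left)
  qed
  have "inv_fourier g = (\<lambda>s. \<Sum>j<n. inv_fourier (\<lambda>s. h j s * g s) s)"
    by (subst eq) (simp add: fun_eq_iff inv_fourier_sum tg)
  then have "convolution (inv_fourier g) u t = (\<Sum>j<n. convolution (inv_fourier (\<lambda>s. h j s * g s)) u t)"
    by (simp add: convolution_sum inv_fourier_schwartz tg)
  then show ?thesis by (simp add: zero)
qed

section \<open>Approximate identities and reproducing kernels\<close>

lemma inv_fourier_dilation:
  assumes "k > 0"
  shows "inv_fourier (\<lambda>s. \<theta> (s / k)) t = of_real k * inv_fourier \<theta> (k * t)"
proof -
  have "fourier (\<lambda>s. \<theta> (s / k)) (- t) = \<bar>k\<bar> *\<^sub>R (LINT s|lborel.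
      exp (- (\<i> * of_real (- t * (0 + k * s)))) * \<theta> ((0 + k * s) / k))"
    unfolding fourier_def by (rule lborel_integral_real_affine) (use assms in simp)
  also have "\<dots> = of_real k * fourier \<theta> (- (k * t))"
    using assms by (simp add: fourier_def scaleR_conv_of_real mult_ac)
  finally show ?thesis
    by (simp add: inv_fourier_def)
qed

lemma test_fun_dilation:
  assumes "test_fun \<theta>" "k > 0"
  shows "test_fun (\<lambda>s. \<theta> (s / k))"
proof -
  obtain A where A: "\<And>s. \<bar>s\<bar> > A \<Longrightarrow> \<theta> s = 0" by (rule test_fun_supportE[OF assms(1)]) blast
  have "smooth (\<lambda>s. \<theta> (inverse k * s + 0))"
    by (intro smooth_affine test_fun_smooth assms)
  moreover have "\<theta> (s / k) = 0" if "\<bar>s\<bar> > A * k" for s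
    using that assms(2) by (intro A) (simp add: field_simps)
  ultimately show ?thesis
    by (intro test_funI[of _ "A * k"]) (simp_all add: divide_inverse mult.commute)
qed

text \<open>The kernel concentrates at scale \<open>1/k\<close>. After the substitution
  \<open>x = t + r/k\<close> the error is an integral of \<open>|w(t + r/k) - w(t)|\<close> against
  a fixed weight, and continuity of \<open>w\<close> at \<open>t\<close> suffices for pointwise
  convergence.\<close>

lemma approximate_identity:
  fixes w :: "real \<Rightarrow>\<^sub>C 'a::complex_banach"
  assumes \<theta>: "test_fun \<theta>" "\<theta> 0 = 1"
  shows "(\<lambda>n. convolution (inv_fourier (\<lambda>s. \<theta> (s / real (Suc n)))) w t) \<longlonglongrightarrow> w t"
proof -
  define \<eta> where "\<eta> = inv_fourier \<theta>"
  obtain B where B: "B \<ge> 0" "\<And>r. cmod (\<eta> r) \<le> B * inverse (1 + r\<^sup>2)"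
    unfolding \<eta>_def by (rule schwartz_decay_0[OF inv_fourier_schwartz[OF \<theta>(1)]]) blast
  have wc: "continuous_on S (apply_bcontfun w)" for S
    by (rule continuous_on_subset[of UNIV]) auto
  have wi: "isCont (apply_bcontfun w) x" for x
    by (metis UNIV_I wc continuous_on_eq_continuous_at open_UNIV)
  have wm: "(\<lambda>r. norm (w (t + c * r) - w t)) \<in> borel_measurable borel" for c
    by (intro borel_measurable_continuous_onI continuous_intros continuous_on_compose2[OF wc[of UNIV]]) auto
  have wb: "norm (w x - w t) \<le> 2 * norm w" for x
    using norm_triangle_ineq4[of "w x" "w t"] norm_bounded[of w x] norm_bounded[of w t] by linarith
  \<comment> \<open>A scalar Lebesgue integral, to which dominated convergence applies; the vector
    values enter only through a norm.\<close>
  define J where "J n = (LINT r|lborel. B * inverse (1 + r\<^sup>2) * norm (w (t + inverse (real (Suc n)) * r) - w t))" for n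
  have bound: "norm (convolution (inv_fourier (\<lambda>s. \<theta> (s / real (Suc n)))) w t - w t) \<le> J n" for n
  proof -
    define k where "k = real (Suc n)"
    have k: "k > 0" by (simp add: k_def)
    define \<phi> where "\<phi> = inv_fourier (\<lambda>s. \<theta> (s / k))"
    have t\<theta>: "test_fun (\<lambda>s. \<theta> (s / k))"
      by (rule test_fun_dilation[OF \<theta>(1) k])
    have \<phi>: "\<phi> \<in> schwartz" unfolding \<phi>_def by (rule inv_fourier_schwartz[OF t\<theta>])
    have \<phi>_int: "integrable lborel \<phi>" by (intro all_moments_integrable schwartz_all_moments \<phi>)
    have "(LINT x|lborel. \<phi> (t + - 1 * x)) = (LINT x|lborel. \<phi> x)"
      using lborel_integral_real_affine[of "- 1" \<phi> t] by simp
    \<comment> \<open>The total mass of a kernel is its transform at 0, here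
      \<open>\<theta> 0 = 1\<close>. It lets \<open>w t\<close> be written as an integral of the
      same kernel.\<close>
    also have "\<dots> = fourier \<phi> 0" by (simp add: fourier_def)
    also have "\<dots> = 1" by (simp add: \<phi>_def fourier_inv_fourier[OF t\<theta>] \<theta>(2))
    finally have "((\<lambda>x. \<phi> (t - x)) has_integral 1) UNIV"
      using has_integral_integral_lborel[OF lborel_integrable_real_affine[OF \<phi>_int, of "- 1" t]] by simp
    from has_integral_linear[OF this scaleC.bounded_linear_left[of "w t"]]
    have I: "((\<lambda>x. \<phi> (t - x) *\<^sub>C w t) has_integral w t) UNIV"
      by (simp add: o_def)
    have I2: "(\<lambda>x. \<phi> (t - x) *\<^sub>C w x) integrable_on UNIV"
      by (rule convolution_integrable(1)[OF \<phi>])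
    define G where "G x = k * (B * inverse (1 + (k * (x - t))\<^sup>2) * norm (w x - w t))" for x
    have wG: "G = (\<lambda>x. (k * (B * inverse (1 + (k * (x - t))\<^sup>2))) * norm (w x - w t))"
      by (simp add: G_def fun_eq_iff mult_ac)
    have G_int: "integrable lborel G"
    proof (rule Bochner_Integration.integrable_bound)
      show "integrable lborel (\<lambda>x. k * (B * inverse (1 + (k * (x - t))\<^sup>2) * (2 * norm w)))"
        using lborel_integrable_real_affine[OF integrable_inverse_square, of k "- k * t"] k
        by (intro integrable_mult_right integrable_mult_left) (simp add: algebra_simps)
      show "G \<in> borel_measurable lborel"
        unfolding G_def using wm[of 1] by (simp, intro borel_measurable_continuous_onI continuous_intros wc)
          (auto simp: add_nonneg_eq_0_iff)
      show "AE x in lborel. norm (G x) \<le> norm (k * (B * inverse (1 + (k * (x - t))\<^sup>2) * (2 * norm w)))"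
        using k B(1) wb by (intro AE_I2) (auto simp: G_def abs_mult intro!: mult_left_mono)
    qed
    have "convolution \<phi> w t - w t = integral UNIV (\<lambda>x. \<phi> (t - x) *\<^sub>C w x - \<phi> (t - x) *\<^sub>C w t)"
      unfolding convolution_def using Henstock_Kurzweil_Integration.integral_diff[OF I2 has_integral_integrable[OF I]]
        integral_unique[OF I] by simp
    also have "norm \<dots> \<le> integral UNIV G"
    proof (rule integral_norm_bound_integral)
      show "(\<lambda>x. \<phi> (t - x) *\<^sub>C w x - \<phi> (t - x) *\<^sub>C w t) integrable_on UNIV"
        by (intro Henstock_Kurzweil_Integration.integrable_diff I2 has_integral_integrable[OF I])
      show "G integrable_on UNIV"
        using has_integral_integral_lborel[OF G_int] by blast
      show "norm (\<phi> (t - x) *\<^sub>C w x - \<phi> (t - x) *\<^sub>C w t) \<le> G x" for x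
      proof -
        have "norm (\<phi> (t - x) *\<^sub>C w x - \<phi> (t - x) *\<^sub>C w t) = cmod (\<phi> (t - x)) * norm (w x - w t)"
          by (simp add: norm_scaleC flip: scaleC.diff_right)
        also have "cmod (\<phi> (t - x)) = k * cmod (\<eta> (k * (t - x)))"
          using k unfolding \<phi>_def \<eta>_def by (simp add: inv_fourier_dilation norm_mult)
        also have "\<dots> * norm (w x - w t) \<le> k * (B * inverse (1 + (k * (t - x))\<^sup>2)) * norm (w x - w t)"
          using k B(2) by (intro mult_right_mono mult_left_mono) auto
        also have "(k * (t - x))\<^sup>2 = (k * (x - t))\<^sup>2"
          by (simp add: power_mult_distrib power2_commute)
        finally show ?thesis by (simp add: G_def mult.assoc)
      qed
    qed
    also have "integral UNIV G = (LINT x|lborel. G x)"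
      by (rule integral_unique[OF has_integral_integral_lborel[OF G_int]])
    also have "\<dots> = \<bar>inverse k\<bar> *\<^sub>R (LINT r|lborel. G (t + inverse k * r))"
      by (rule lborel_integral_real_affine) (use k in simp)
    also have "\<dots> = J n"
      using k unfolding G_def J_def k_def[symmetric] by (simp add: mult.assoc flip: mult.assoc[of k "inverse k"])
    finally show ?thesis by (simp add: \<phi>_def k_def)
  qed
  have "J \<longlonglongrightarrow> (LINT r|lborel. B * inverse (1 + r\<^sup>2) * norm (w (t + 0 * r) - w t))"
    unfolding J_def
  proof (rule integral_dominated_convergence[where w = "\<lambda>r. B * inverse (1 + r\<^sup>2) * (2 * norm w)"])
    show "integrable lborel (\<lambda>r. B * inverse (1 + r\<^sup>2) * (2 * norm w))"
      by (intro integrable_mult_right integrable_mult_left integrable_inverse_square)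
    show "AE r in lborel. (\<lambda>n. B * inverse (1 + r\<^sup>2) * norm (w (t + inverse (real (Suc n)) * r) - w t))
        \<longlonglongrightarrow> B * inverse (1 + r\<^sup>2) * norm (w (t + 0 * r) - w t)"
    proof (rule AE_I2)
      fix r :: real
      have "(\<lambda>n. t + inverse (real (Suc n)) * r) \<longlonglongrightarrow> t + 0 * r"
        by (intro tendsto_intros LIMSEQ_inverse_real_of_nat)
      then have "(\<lambda>n. w (t + inverse (real (Suc n)) * r)) \<longlonglongrightarrow> w (t + 0 * r)"
        by (rule isCont_tendsto_compose[rotated]) (rule wi)
      then show "(\<lambda>n. B * inverse (1 + r\<^sup>2) * norm (w (t + inverse (real (Suc n)) * r) - w t))
          \<longlonglongrightarrow> B * inverse (1 + r\<^sup>2) * norm (w (t + 0 * r) - w t)"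
        by (intro tendsto_intros)
    qed
    show "AE r in lborel. norm (B * inverse (1 + r\<^sup>2) * norm (w (t + inverse (real (Suc n)) * r) - w t))
        \<le> B * inverse (1 + r\<^sup>2) * (2 * norm w)" for n
      using B(1) wb by (intro AE_I2) (auto simp: abs_mult intro!: mult_left_mono)
  qed (use wm in simp_all)
  then have "J \<longlonglongrightarrow> 0" by simp
  then have "(\<lambda>n. convolution (inv_fourier (\<lambda>s. \<theta> (s / real (Suc n)))) w t - w t) \<longlonglongrightarrow> 0"
    by (rule Lim_null_comparison[OF always_eventually[OF allI[OF bound]]])
  then show ?thesis
    by (simp add: LIM_zero_iff)
qed

text \<open>The approximating convolutions are eventually constant in the dilation parameter and
  equal to the left side, while their limit is the right side.\<close>

lemma convolution_reproducing:
  fixes u :: "real \<Rightarrow>\<^sub>C 'a::complex_banach"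
  assumes \<mu>: "Re \<mu> \<noteq> 0" and bdd: "bounded (beurling_spectrum u)"
    and \<kappa>: "test_fun \<kappa>" "open N" "beurling_spectrum u \<subseteq> N" "\<And>s. s \<in> N \<Longrightarrow> \<kappa> s = 1"
  shows "convolution (inv_fourier \<kappa>) ((diff_resolvent \<mu> ^^ n) u) t = (diff_resolvent \<mu> ^^ n) u t"
proof -
  let ?w = "(diff_resolvent \<mu> ^^ n) u"
  obtain \<theta> V where \<theta>: "test_fun \<theta>" "open V" "{0} \<subseteq> V" "\<And>s. s \<in> V \<Longrightarrow> \<theta> s = 1"
    using smooth_Urysohn[of "{0}" UNIV] by (metis compact_sing open_UNIV subset_UNIV)
  obtain r where r: "r > 0" "ball 0 r \<subseteq> V"
    using \<theta>(2,3) by (meson insert_subset openE)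
  have \<theta>1: "\<theta> s = 1" if "\<bar>s\<bar> < r" for s
    using that r by (intro \<theta>(4)) (auto simp: dist_real_def)
  obtain b where b: "\<And>s. s \<in> beurling_spectrum u \<Longrightarrow> \<bar>s\<bar> \<le> b"
    using bdd by (auto simp: bounded_iff)
  \<comment> \<open>From \<open>m0\<close> on, the interval of radius \<open>r k\<close> on which
    \<open>\<theta> (s / k)\<close> is 1 contains the spectrum.\<close>
  obtain m0 :: nat where m0: "b / r < real m0"
    using reals_Archimedean2 by blast
  have "convolution (inv_fourier (\<lambda>s. \<theta> (s / real (Suc m)))) ?w t = convolution (inv_fourier \<kappa>) ?w t"
    if "m \<ge> m0" for m
  proof -
    define k where "k = real (Suc m)"
    have k: "k > 0" "b < r * k"
    proof -
      show "k > 0" by (simp add: k_def)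
      have "b / r < k" using m0 that by (simp add: k_def)
      then show "b < r * k" using r(1) by (simp add: field_simps)
    qed
    have t\<theta>: "test_fun (\<lambda>s. \<theta> (s / k))"
      by (rule test_fun_dilation[OF \<theta>(1) k(1)])
    define g where "g s = \<theta> (s / k) - \<kappa> s" for s
    have tg: "test_fun g" unfolding g_def by (intro test_fun_diff t\<theta> \<kappa>)
    \<comment> \<open>Vanishing off the spectrum is known for convolutions with \<open>u\<close>.
      Dividing the symbol by the n-th power turns a convolution with \<open>?w\<close> into one with
      \<open>u\<close> and leaves the support unchanged.\<close>
    let ?g = "\<lambda>s. inverse (\<mu> - \<i> * of_real s) ^ n * g s"
    have "test_fun ?g"
      by (intro test_fun_mult tg smooth_power smooth_inverse smooth_symbol symbol_nonzero \<mu>)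
    moreover have "closure {s. ?g s \<noteq> 0} \<inter> beurling_spectrum u = {}"
    proof -
      \<comment> \<open>The closure of the support has to avoid the spectrum, so \<open>?g\<close>
        must vanish on an open neighbourhood and not merely on the spectrum.\<close>
      have "open (N \<inter> {- (r * k)<..<r * k})" using \<kappa>(2) by auto
      moreover have zero: "?g s = 0" if "s \<in> N \<inter> {- (r * k)<..<r * k}" for s
      proof -
        have "\<bar>s / k\<bar> < r" using that k by (auto simp: abs_less_iff field_simps)
        then show ?thesis using that \<kappa>(4) \<theta>1 by (simp add: g_def)
      qed
      ultimately have "closure {s. ?g s \<noteq> 0} \<subseteq> - (N \<inter> {- (r * k)<..<r * k})"
        by (intro closure_minimal closed_Compl subsetI) (use zero in blast)
      moreover have "beurling_spectrum u \<subseteq> N \<inter> {- (r * k)<..<r * k}"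
        using \<kappa>(3) b k(2) by (fastforce simp: abs_le_iff)
      ultimately show ?thesis by blast
    qed
    ultimately have "convolution (inv_fourier ?g) u t = 0"
      by (rule convolution_eq_0_off_spectrum)
    then have "convolution (inv_fourier g) ?w t = 0"
      by (simp only: convolution_resolvent_power_inverse[OF \<mu> tg])
    then show ?thesis
      unfolding g_def convolution_inv_fourier_diff[OF t\<theta> \<kappa>(1)] by (simp add: k_def)
  qed
  then have "\<forall>\<^sub>F m in sequentially. convolution (inv_fourier \<kappa>) ?w t = convolution (inv_fourier (\<lambda>s. \<theta> (s / real (Suc m)))) ?w t"
    unfolding eventually_sequentially by (intro exI[of _ m0]) simp
  then have "(\<lambda>m. convolution (inv_fourier (\<lambda>s. \<theta> (s / real (Suc m)))) ?w t) \<longlonglongrightarrow> convolution (inv_fourier \<kappa>) ?w t"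
    by (rule Lim_transform_eventually[OF tendsto_const])
  moreover have "(\<lambda>m. convolution (inv_fourier (\<lambda>s. \<theta> (s / real (Suc m)))) ?w t) \<longlonglongrightarrow> ?w t"
    using \<theta> by (intro approximate_identity) auto
  ultimately show ?thesis
    by (rule LIMSEQ_unique)
qed

section \<open>Growth of the resolvent powers\<close>

text \<open>A fixed nonzero vector is recovered from every resolvent power by a kernel of controlled
  mass, so these powers cannot decay faster than that mass grows.\<close>

lemma resolvent_power_lower_bound:
  fixes u :: "real \<Rightarrow>\<^sub>C 'a::complex_banach"
  assumes \<mu>: "Re \<mu> \<noteq> 0" and \<xi>: "\<xi> \<in> beurling_spectrum u" and \<epsilon>: "\<epsilon> > 0"
  obtains c K where "c > 0"
    "\<And>n. c \<le> K * (real (n + 1))\<^sup>2 * (cmod (\<mu> - \<i> * of_real \<xi>) + \<epsilon>) ^ n * norm ((diff_resolvent \<mu> ^^ n) u)"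
proof -
  obtain \<phi> t where \<phi>: "\<phi> \<in> schwartz" "closure {s. fourier \<phi> s \<noteq> 0} \<subseteq> {\<xi> - \<epsilon><..<\<xi> + \<epsilon>}"
      "convolution \<phi> u t \<noteq> 0"
    using \<xi> \<epsilon> unfolding beurling_spectrum_def by blast
  define h where "h = fourier \<phi>"
  have "bounded {s. fourier \<phi> s \<noteq> 0}"
  proof (rule bounded_subset[OF bounded_closed_interval])
    show "{s. fourier \<phi> s \<noteq> 0} \<subseteq> {\<xi> - \<epsilon>..\<xi> + \<epsilon>}"
      using \<phi>(2) closure_subset[of "{s. fourier \<phi> s \<noteq> 0}"] by fastforce
  qed
  from schwartz_band_limited[OF \<phi>(1) this]
  have h: "test_fun h" "inv_fourier h = \<phi>" by (simp_all add: h_def)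
  let ?p = "\<lambda>s. \<mu> - \<i> * complex_of_real s"
  let ?M = "cmod (\<mu> - \<i> * of_real \<xi>) + \<epsilon>"
  have nz: "?p s \<noteq> 0" for s using symbol_nonzero[OF \<mu>] .
  have M: "cmod (?p s) \<le> ?M" if "s \<in> closure {s. h s \<noteq> 0}" for s
  proof -
    have "s \<in> {\<xi> - \<epsilon><..<\<xi> + \<epsilon>}" using that \<phi>(2) unfolding h_def by blast
    then have "\<bar>\<xi> - s\<bar> \<le> \<epsilon>" by auto
    moreover have "?p s = (\<mu> - \<i> * of_real \<xi>) + \<i> * of_real (\<xi> - s)" by (simp add: algebra_simps)
    then have "cmod (?p s) \<le> cmod (\<mu> - \<i> * of_real \<xi>) + cmod (\<i> * of_real (\<xi> - s))"
      by (metis norm_triangle_ineq)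
    ultimately show ?thesis by (simp add: norm_mult del: of_real_diff)
  qed
  \<comment> \<open>The logarithmic derivative of the symbol is smooth because the symbol has no
    real zero.\<close>
  have d: "(?p has_vector_derivative ?p s * (- \<i> * inverse (?p s))) (at s)" for s
  proof -
    have "(?p has_vector_derivative - \<i>) (at s)"
      by (auto intro!: derivative_eq_intros)
    moreover have "?p s * (- \<i> * inverse (?p s)) = - \<i>" using nz[of s] by simp
    ultimately show ?thesis by (simp only:)
  qed
  have q: "smooth (\<lambda>s. - \<i> * inverse (?p s))"
    by (intro smooth_mult smooth_const smooth_inverse smooth_symbol nz)
  obtain K where K: "\<And>n t. cmod (inv_fourier (\<lambda>s. ?p s ^ n * h s) t) \<le> K * (real (n + 1))\<^sup>2 * ?M ^ n * inverse (1 + t\<^sup>2)"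
    by (rule inv_fourier_power_mult_decay[OF smooth_symbol d q h(1) M]) (use \<epsilon> in auto)
  show ?thesis
  proof (rule that[of "norm (convolution \<phi> u t)" "K * poisson_mass"])
    show "norm (convolution \<phi> u t) > 0" using \<phi>(3) by simp
    fix n
    have "test_fun (\<lambda>s. ?p s ^ n * h s)"
      by (intro test_fun_mult smooth_power smooth_symbol h)
    from norm_convolution_le[OF inv_fourier_schwartz[OF this] K]
    have "norm (convolution \<phi> u t) \<le> K * (real (n + 1))\<^sup>2 * ?M ^ n * poisson_mass * norm ((diff_resolvent \<mu> ^^ n) u)"
      unfolding h(2)[symmetric] convolution_resolvent_power[OF \<mu> h(1), of u t n] .
    then show "norm (convolution \<phi> u t) \<le> K * poisson_mass * (real (n + 1))\<^sup>2 * ?M ^ n * norm ((diff_resolvent \<mu> ^^ n) u)"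
      by (simp only: mult_ac)
  qed
qed

text \<open>The strict inequality holds on an open set around the spectrum, which leaves room for a
  cutoff on whose closed support the reciprocal symbol is still bounded by \<open>a\<close>.\<close>

lemma resolvent_power_upper_bound:
  fixes u :: "real \<Rightarrow>\<^sub>C 'a::complex_banach"
  assumes \<mu>: "Re \<mu> \<noteq> 0" and spec: "compact (beurling_spectrum u)" and a: "a > 0"
    "\<And>\<xi>. \<xi> \<in> beurling_spectrum u \<Longrightarrow> inverse (cmod (\<mu> - \<i> * of_real \<xi>)) < a"
  obtains K where "\<And>n. norm ((diff_resolvent \<mu> ^^ n) u) \<le> K * (real (n + 1))\<^sup>2 * a ^ n"
proof -
  let ?p = "\<lambda>s. inverse (\<mu> - \<i> * complex_of_real s)"
  have nz: "\<mu> - \<i> * complex_of_real s \<noteq> 0" for s using symbol_nonzero[OF \<mu>] .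
  define U where "U = {s. inverse (cmod (\<mu> - \<i> * of_real s)) < a}"
  have "open U"
    unfolding U_def using nz by (intro open_Collect_less continuous_intros) auto
  moreover have "beurling_spectrum u \<subseteq> U" using a(2) by (auto simp: U_def)
  ultimately obtain \<kappa> N where \<kappa>: "test_fun \<kappa>" "open N" "beurling_spectrum u \<subseteq> N"
      "\<And>s. s \<in> N \<Longrightarrow> \<kappa> s = 1" "closure {s. \<kappa> s \<noteq> 0} \<subseteq> U"
    by (rule smooth_Urysohn[OF spec]) blast
  have M: "cmod (?p s) \<le> a" if "s \<in> closure {s. \<kappa> s \<noteq> 0}" for s
    using that \<kappa>(5) by (auto simp: U_def norm_inverse)
  have d: "(?p has_vector_derivative ?p s * (\<i> * ?p s)) (at s)" for s
  proof -
    have "((\<lambda>s. \<mu> - \<i> * complex_of_real s) has_vector_derivative - \<i>) (at s)"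
      by (auto intro!: derivative_eq_intros)
    from Deriv.has_derivative_inverse[OF nz this[unfolded has_vector_derivative_def]]
    show ?thesis unfolding has_vector_derivative_def by (simp add: mult_ac)
  qed
  have p: "smooth ?p" "smooth (\<lambda>s. \<i> * ?p s)"
    by (intro smooth_mult smooth_const smooth_inverse smooth_symbol nz)+
  obtain K where K: "\<And>n t. cmod (inv_fourier (\<lambda>s. ?p s ^ n * \<kappa> s) t) \<le> K * (real (n + 1))\<^sup>2 * a ^ n * inverse (1 + t\<^sup>2)"
    by (rule inv_fourier_power_mult_decay[OF p(1) d p(2) \<kappa>(1) M]) (use a in auto)
  show ?thesis
  proof (rule that[of "K * poisson_mass * norm u"])
    fix n
    have tp: "test_fun (\<lambda>s. ?p s ^ n * \<kappa> s)"
      by (intro test_fun_mult smooth_power p \<kappa>)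
    have "(diff_resolvent \<mu> ^^ n) u t = convolution (inv_fourier (\<lambda>s. ?p s ^ n * \<kappa> s)) u t" for t
      by (rule trans[OF convolution_reproducing[OF \<mu> compact_imp_bounded[OF spec] \<kappa>(1-4), symmetric]
          convolution_resolvent_power_inverse[OF \<mu> \<kappa>(1)]])
    then have "norm ((diff_resolvent \<mu> ^^ n) u t) \<le> K * (real (n + 1))\<^sup>2 * a ^ n * poisson_mass * norm u" for t
      using norm_convolution_le[OF inv_fourier_schwartz[OF tp] K, of u t] by simp
    then have "norm ((diff_resolvent \<mu> ^^ n) u) \<le> K * (real (n + 1))\<^sup>2 * a ^ n * poisson_mass * norm u"
      by (rule norm_bound)
    then show "norm ((diff_resolvent \<mu> ^^ n) u) \<le> K * poisson_mass * norm u * (real (n + 1))\<^sup>2 * a ^ n"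
      by (simp only: mult_ac)
  qed
qed

section \<open>Passing to n-th roots\<close>

lemma root_quadratic_tendsto_1:
  assumes "C > 0"
  shows "(\<lambda>n. root n (C * (real (n + 1))\<^sup>2)) \<longlonglongrightarrow> 1"
proof -
  have "(\<lambda>n. (C * (real n + 1)\<^sup>2) powr (1 / real n)) \<longlonglongrightarrow> 1"
    using assms by real_asymp
  \<comment> \<open>The two expressions differ at index 0, where \<open>root 0\<close> is 0 by
    convention.\<close>
  moreover have "\<forall>\<^sub>F n in sequentially. (C * (real n + 1)\<^sup>2) powr (1 / real n) = root n (C * (real (n + 1))\<^sup>2)"
    using assms by (intro eventually_mono[OF eventually_gt_at_top[of 0]])
      (auto simp: root_powr_inverse add.commute)
  ultimately show ?thesis
    by (rule Lim_transform_eventually)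
qed

lemma liminf_root_ge:
  fixes r :: "nat \<Rightarrow> real"
  assumes c: "c > 0" and M: "M > 0" and r: "\<And>n. r n \<ge> 0"
    and bound: "\<And>n. c \<le> K * (real (n + 1))\<^sup>2 * M ^ n * r n"
  shows "ereal (inverse M) \<le> liminf (\<lambda>n. ereal (root n (r n)))"
proof -
  \<comment> \<open>At index 0 the bound reads \<open>c \<le> K r(0)\<close> with \<open>c\<close>
    positive and \<open>r(0)\<close> nonnegative.\<close>
  have "K > 0"
    using bound[of 0] c r[of 0] by (auto simp: zero_less_mult_iff dest: less_le_trans)
  let ?L = "\<lambda>n. inverse (root n (K / c * (real (n + 1))\<^sup>2) * M)"
  have "?L \<longlonglongrightarrow> inverse (1 * M)"
    using c M \<open>K > 0\<close> by (intro tendsto_intros root_quadratic_tendsto_1) auto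
  then have "(\<lambda>n. ereal (?L n)) \<longlonglongrightarrow> ereal (inverse M)" by simp
  then have "liminf (\<lambda>n. ereal (?L n)) = ereal (inverse M)"
    by (intro lim_imp_Liminf) auto
  moreover have "liminf (\<lambda>n. ereal (?L n)) \<le> liminf (\<lambda>n. ereal (root n (r n)))"
  proof (intro Liminf_mono eventually_mono[OF eventually_gt_at_top[of 0]])
    fix n :: nat assume n: "0 < n"
    have "inverse (K / c * (real (n + 1))\<^sup>2 * M ^ n) \<le> r n"
      using bound[of n] c M \<open>K > 0\<close> by (simp add: field_simps)
    then have "root n (inverse (K / c * (real (n + 1))\<^sup>2 * M ^ n)) \<le> root n (r n)"
      using n by simp
    moreover have "root n (inverse (K / c * (real (n + 1))\<^sup>2 * M ^ n)) = ?L n"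
      using n M by (simp only: real_root_inverse real_root_mult real_root_power_cancel less_imp_le)
    ultimately show "ereal (?L n) \<le> ereal (root n (r n))" by simp
  qed
  ultimately show ?thesis by simp
qed

theorem theorem2:
  fixes u :: "real \<Rightarrow>\<^sub>C 'a::complex_banach" and \<mu> :: complex
  assumes "Re \<mu> \<noteq> 0"
  shows "liminf (\<lambda>n. ereal (root n (norm ((diff_resolvent \<mu> ^^ n) u))))
           \<ge> ereal (sup0 {inverse (cmod (\<mu> - \<i> * of_real \<xi>)) | \<xi>. \<xi> \<in> beurling_spectrum u})
    \<and> (compact (beurling_spectrum u) \<longrightarrow>
        (\<lambda>n. root n (norm ((diff_resolvent \<mu> ^^ n) u)))
          \<longlonglongrightarrow> sup0 {inverse (cmod (\<mu> - \<i> * of_real \<xi>)) | \<xi>. \<xi> \<in> beurling_spectrum u})"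
proof -
  let ?r = "\<lambda>n. norm ((diff_resolvent \<mu> ^^ n) u)"
  let ?X = "{inverse (cmod (\<mu> - \<i> * of_real \<xi>)) | \<xi>. \<xi> \<in> beurling_spectrum u}"
  let ?L = "liminf (\<lambda>n. ereal (root n (?r n)))"
  \<comment> \<open>This settles the empty spectrum, where \<open>sup0\<close> is 0, and excludes
    the value minus infinity otherwise.\<close>
  have L0: "0 \<le> ?L"
    by (intro Liminf_bounded always_eventually) (simp add: real_root_pos_pos_le)
  have point: "ereal (inverse (cmod (\<mu> - \<i> * of_real \<xi>))) \<le> ?L" if \<xi>: "\<xi> \<in> beurling_spectrum u" for \<xi>
  proof -
    let ?d = "cmod (\<mu> - \<i> * of_real \<xi>)"
    have d: "?d > 0" using symbol_nonzero[OF assms] by simp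
    have le: "ereal (inverse (?d + \<epsilon>)) \<le> ?L" if \<epsilon>: "\<epsilon> > 0" for \<epsilon>
    proof -
      obtain c K where cK: "c > 0" "\<And>n. c \<le> K * (real (n + 1))\<^sup>2 * (?d + \<epsilon>) ^ n * ?r n"
        by (rule resolvent_power_lower_bound[OF assms \<xi> \<epsilon>]) blast
      show ?thesis
        by (rule liminf_root_ge[OF cK(1) _ norm_ge_zero cK(2)]) (use add_pos_pos[OF d \<epsilon>] in simp)
    qed
    \<comment> \<open>The loss \<open>\<epsilon>\<close> comes from the variation of the symbol over
      the support of the chosen function; it disappears in the limit.\<close>
    have "((\<lambda>\<epsilon>. inverse (?d + \<epsilon>)) \<longlongrightarrow> inverse (?d + 0)) (at_right 0)"
      using d by (intro tendsto_intros) auto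
    then have "((\<lambda>\<epsilon>. ereal (inverse (?d + \<epsilon>))) \<longlongrightarrow> ereal (inverse ?d)) (at_right 0)"
      by simp
    then show ?thesis
      by (rule tendsto_upperbound) (use le in \<open>auto intro: eventually_mono[OF eventually_at_right_less]\<close>)
  qed
  have lower: "ereal (sup0 ?X) \<le> ?L"
  proof (cases "?X = {}")
    case True
    then show ?thesis using L0 by (simp add: sup0_def zero_ereal_def)
  next
    case False
    show ?thesis
    proof (cases ?L)
      case (real l)
      then have "Sup ?X \<le> l"
        using point by (intro cSup_least[OF False]) auto
      then show ?thesis using real False by (simp add: sup0_def)
    qed (use L0 in auto)
  qed
  have sup_upper: "x \<le> sup0 ?X" if "x \<in> ?X" for x
  proof -
    have "x \<le> Sup ?X"
      by (rule cSup_upper[OF that bdd_above_inverse_dist_imaginary_axis[OF assms]])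
    moreover have "?X \<noteq> {}" using that by blast
    ultimately show ?thesis by (simp only: sup0_def if_False)
  qed
  have sup_nonneg: "sup0 ?X \<ge> 0"
  proof (cases "?X = {}")
    case True
    then show ?thesis by (simp add: sup0_def)
  next
    case False
    then obtain x where x: "x \<in> ?X" by blast
    then have "x \<ge> 0" by auto
    then show ?thesis using sup_upper[OF x] by linarith
  qed
  have "(\<lambda>n. root n (?r n)) \<longlonglongrightarrow> sup0 ?X" if spec: "compact (beurling_spectrum u)"
  proof (rule order_tendstoI)
    fix y assume "y < sup0 ?X"
    then have "ereal y < ereal (sup0 ?X)" by (simp only: less_ereal.simps(1))
    then have "ereal y < ?L" using lower by (rule less_le_trans)
    then have "\<forall>\<^sub>F n in sequentially. ereal y < ereal (root n (?r n))"
      by (rule less_LiminfD)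
    then show "\<forall>\<^sub>F n in sequentially. y < root n (?r n)" by simp
  next
    fix y assume y: "sup0 ?X < y"
    \<comment> \<open>The number \<open>a\<close> strictly exceeds the reciprocal symbol on the
      spectrum, and the gap up to \<open>y\<close> absorbs the n-th root of the polynomial factor.
      For an empty spectrum any positive \<open>a\<close> below \<open>y\<close> will do, which
      yields the limit 0.\<close>
    then obtain a where a: "sup0 ?X < a" "a < y" using dense by blast
    have a0: "a > 0" using a sup_nonneg by linarith
    have "inverse (cmod (\<mu> - \<i> * of_real \<xi>)) < a" if "\<xi> \<in> beurling_spectrum u" for \<xi>
      by (rule le_less_trans[OF sup_upper a(1)]) (use that in blast)
    then obtain K where K: "\<And>n. ?r n \<le> K * (real (n + 1))\<^sup>2 * a ^ n"
      by (rule resolvent_power_upper_bound[OF assms spec a0]) blast+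
    \<comment> \<open>The constant under the root has to be positive, which is not known of
      \<open>K\<close>.\<close>
    let ?K = "max K 1"
    have "(\<lambda>n. root n (?K * (real (n + 1))\<^sup>2) * a) \<longlonglongrightarrow> 1 * a"
      by (intro tendsto_intros root_quadratic_tendsto_1) auto
    then have "\<forall>\<^sub>F n in sequentially. root n (?K * (real (n + 1))\<^sup>2) * a < y"
      using a by (intro order_tendstoD(2)) auto
    then show "\<forall>\<^sub>F n in sequentially. root n (?r n) < y"
      using eventually_gt_at_top[of 0]
    proof eventually_elim
      case (elim n)
      have "?r n \<le> ?K * (real (n + 1))\<^sup>2 * a ^ n"
        by (rule order_trans[OF K]) (use a0 in \<open>auto intro!: mult_right_mono\<close>)
      then have "root n (?r n) \<le> root n (?K * (real (n + 1))\<^sup>2 * a ^ n)"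
        using elim by simp
      also have "\<dots> = root n (?K * (real (n + 1))\<^sup>2) * a"
        using elim a0 by (simp only: real_root_mult real_root_power_cancel less_imp_le)
      finally show ?case using elim by linarith
    qed
  qed
  with lower show ?thesis by blast
qed

end
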